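(* Let $X$ be the symmetric pure jump Hunt process on $\mathbb{R}^d\setminus\mathcal{N}$ described in the context. For every $R>0$ there exists a nondecreasing function $\varphi:(0,1)\to(0,1)$ such that for all $x_0\in\mathbb{R}^d$, all $x\in Q(x_0,R/2)\setminus\mathcal{N}$ and all Borel sets $B\subseteq Q(x_0,R)$ with $0<|B|<R^d$, $$\mathbb{E}^x\int_0^{\tau_{Q(x_0,R)}}1_B(X_s)\,ds\;\geq\;\varphi\left(\frac{|B|}{R^d}\right).$$
   Context: Setting. Let $d\ge 1$ and let $J:\mathbb{R}^d\times\mathbb{R}^d\to[0,\infty)$ be a measurable jump kernel such that: (a) $J(x,y)=J(y,x)$ for all $x,y$; (b) $J(x,y)=0$ for $|x-y|\ge 1$; (c) there are $\alpha\in(0,2)$ and $\kappa_1,\kappa_2>0$ with $\kappa_1|y-x|^{-d-\alpha}\le J(x,y)\le\kappa_2|y-x|^{-d-\alpha}$ whenever $|x-y|<1$. Let $\mathcal{E}(f,f)=\int_{\mathbb{R}^d}\int_{\mathbb{R}^d}(f(y)-f(x))^2J(x,y)\,dx\,dy$, let $\mathcal{E}_1(f,f)=\mathcal{E}(f,f)+\|f\|_2^2$, and let $\mathcal{F}$ be the closure of $C_c^1(\mathbb{R}^d)$ (the $C^1$ functions with compact support) with respect to the metric $\mathcal{E}_1(f,f)^{1/2}$. It is known (Barlow–Bass–Chen–Kassmann) that there is a conservative Hunt process $X=(X_t)$ associated with the Dirichlet form $(\mathcal{E},\mathcal{F})$, with state space $\mathbb{R}^d\setminus\mathcal{N}$,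 where $\mathcal{N}$ is a properly exceptional set (of zero capacity, hence of zero Lebesgue measure), and that $X$ has a symmetric transition density $p(t,x,y)$ with respect to Lebesgue measure. $\mathbb{P}^x,\mathbb{E}^x$ denote probability and expectation for $X$ started at $x$. For an open ball $D$, $p^D(t,x,y)$ denotes the transition density of $X$ killed upon exiting $D$. Throughout, $\mathcal{N}$ is a fixed properly exceptional set for which the following known estimates hold: (i) $p(t,x,y)\le c_1t^{-d/\alpha}e^{c_2t}$ for all $t>0$, $x,y\in\mathbb{R}^d\setminus\mathcal{N}$; (ii) $p(t,x,y)\le c_3te^{-c_4|x-y|}$ for $t\in(0,2]$, $x,y\in\mathbb{R}^d\setminus\mathcal{N}$ with $|x-y|\ge 1/16$; (iii) for $T>1/2$, $\delta\in(0,1/2)$, $R>0$, $\epsilon\in(0,1)$ there is $C>0$ depending only on $R,T,\alpha,\kappa_1,\kappa_2,\delta,\epsilon$ (and $d$) such that for every $y_0\in\mathbb{R}^d$, with $D=B(y_0,R)$, $p^D(t,x,y)\ge C$ for all $t\in[\delta,T]$ and $x,y\in B(y_0,\epsilon R)\setminus\mathcal{N}$. Notation. $B(x,r)$ is the open ball of radius $r$ centered at $x$; $Q(x,r)$ is the (open, axis-parallel) cube of side length $r$ centered at $x$; $|A|$ is the Lebesgue measure of $A$; $\tau_A=\inf\{t>0:X_t\notin A\}$ is the exit time of $A$. *)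

theory Defs
  imports "HOL-Probability.Probability"
begin

section \<open>Jump kernels and their Dirichlet forms\<close>

text \<open>The two-sided bound is only required off the diagonal: at \<open>x = y\<close> the comparison function
  \<open>\<bar>y - x\<bar>\<close> to the power \<open>-d-\<alpha>\<close> is infinite on paper, whereas \<open>0 powr _ = 0\<close>.\<close>

locale jump_kernel =
  fixes J :: "'a::euclidean_space \<Rightarrow> 'a \<Rightarrow> real" and \<alpha> \<kappa>1 \<kappa>2 :: real
  assumes measurable_J: "(\<lambda>(x, y). J x y) \<in> borel_measurable (borel \<Otimes>\<^sub>M borel)"
    and nonneg_J: "0 \<le> J x y"
    and sym_J: "J x y = J y x"
    and finite_range_J: "1 \<le> norm (x - y) \<Longrightarrow> J x y = 0"
    and \<alpha>: "0 < \<alpha>" "\<alpha> < 2"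
    and \<kappa>: "0 < \<kappa>1" "0 < \<kappa>2"
    and lower_J: "x \<noteq> y \<Longrightarrow> norm (x - y) < 1 \<Longrightarrow>
      \<kappa>1 * norm (y - x) powr (- real DIM('a) - \<alpha>) \<le> J x y"
    and upper_J: "x \<noteq> y \<Longrightarrow> norm (x - y) < 1 \<Longrightarrow>
      J x y \<le> \<kappa>2 * norm (y - x) powr (- real DIM('a) - \<alpha>)"

definition square_integrable :: "('a::euclidean_space \<Rightarrow> real) set" where
  "square_integrable = {f \<in> borel_measurable borel. integrable lborel (\<lambda>x. (f x)\<^sup>2)}"

definition C1_compact_support :: "('a::euclidean_space \<Rightarrow> real) set" where
  "C1_compact_support =
    {f. compact (closure {x. f x \<noteq> 0}) \<and>
        (\<exists>f' :: 'a \<Rightarrow> 'a \<Rightarrow>\<^sub>L real.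
           continuous_on UNIV f' \<and> (\<forall>x. (f has_derivative blinfun_apply (f' x)) (at x)))}"

text \<open>The energy takes values in \<open>[0, \<infinity>]\<close>, so that it makes sense for every measurable function.\<close>

definition energy ::
  "('a::euclidean_space \<Rightarrow> 'a \<Rightarrow> real) \<Rightarrow> ('a \<Rightarrow> real) \<Rightarrow> ennreal" where
  "energy J f = (\<integral>\<^sup>+x. (\<integral>\<^sup>+y. ennreal ((f y - f x)\<^sup>2 * J x y) \<partial>lborel) \<partial>lborel)"

definition energy1 ::
  "('a::euclidean_space \<Rightarrow> 'a \<Rightarrow> real) \<Rightarrow> ('a \<Rightarrow> real) \<Rightarrow> ennreal" where
  "energy1 J f = energy J f + (\<integral>\<^sup>+x. ennreal ((f x)\<^sup>2) \<partial>lborel)"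

definition form_domain ::
  "('a::euclidean_space \<Rightarrow> 'a \<Rightarrow> real) \<Rightarrow> ('a \<Rightarrow> real) set" where
  "form_domain J =
    {f \<in> square_integrable. \<exists>g :: nat \<Rightarrow> 'a \<Rightarrow> real.
       range g \<subseteq> C1_compact_support \<and> (\<lambda>n. energy1 J (\<lambda>x. g n x - f x)) \<longlonglongrightarrow> 0}"

definition capacity ::
  "('a::euclidean_space \<Rightarrow> 'a \<Rightarrow> real) \<Rightarrow> 'a set \<Rightarrow> ennreal" where
  "capacity J A =
    (INF G \<in> {G. open G \<and> A \<subseteq> G}.
     INF u \<in> {u \<in> form_domain J. AE x in lborel. x \<in> G \<longrightarrow> 1 \<le> u x}. energy1 J u)"

section \<open>Conservative Hunt processes\<close>

text \<open>A Hunt process with state space \<open>S\<close> whose lifetime is infinite, so that no cemetery point is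
  needed. Only the measurable structure of \<open>M\<close> matters. The filtration is indexed by \<open>ennreal\<close> in
  order that stopping times may be infinite. The requirement that the paths and their left limits
  stay in \<open>S\<close> is the invariance clause in the definition of a properly exceptional set,
  here the complement of \<open>S\<close>.\<close>

locale conservative_hunt_process =
  fixes S :: "'a::euclidean_space set"
    and M :: "'w measure"
    and F :: "ennreal \<Rightarrow> 'w measure"
    and X :: "real \<Rightarrow> 'w \<Rightarrow> 'a"
    and P :: "'a \<Rightarrow> 'w measure"
  assumes prob_space_P: "x \<in> S \<Longrightarrow> prob_space (P x)"
    and sets_P: "x \<in> S \<Longrightarrow> sets (P x) = sets M"
    and measurable_P: "0 \<le> t \<Longrightarrow> A \<in> sets borel \<Longrightarrow>
      (\<lambda>x. emeasure (P x) (X t -` A \<inter> space M)) \<in> borel_measurable (restrict_space borel S)"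
    and filtration_F: "filtration (space M) F"
    and sets_F: "sets (F t) \<subseteq> sets M"
    and right_continuous_F: "t < \<top> \<Longrightarrow> sets (F t) = (\<Inter>s \<in> {t<..}. sets (F s))"
    and adapted_X: "0 \<le> t \<Longrightarrow> X t \<in> borel_measurable (F (ennreal t))"
    and X_in_S: "\<omega> \<in> space M \<Longrightarrow> 0 \<le> t \<Longrightarrow> X t \<omega> \<in> S"
    and right_continuous_X: "\<omega> \<in> space M \<Longrightarrow> 0 \<le> t \<Longrightarrow>
      ((\<lambda>s. X s \<omega>) \<longlongrightarrow> X t \<omega>) (at_right t)"
    and left_limit_X: "\<omega> \<in> space M \<Longrightarrow> 0 < t \<Longrightarrow>
      \<exists>l \<in> S. ((\<lambda>s. X s \<omega>) \<longlongrightarrow> l) (at_left t)"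
    and normal: "x \<in> S \<Longrightarrow> AE \<omega> in P x. X 0 \<omega> = x"
    and strong_markov: "x \<in> S \<Longrightarrow> stopping_time F T \<Longrightarrow>
      \<Lambda> \<in> sets (filtration.pre_sigma (space M) F T) \<Longrightarrow> 0 \<le> s \<Longrightarrow> A \<in> sets borel \<Longrightarrow>
      emeasure (P x) {\<omega> \<in> \<Lambda>. T \<omega> < \<top> \<and> X (enn2real (T \<omega>) + s) \<omega> \<in> A} =
      (\<integral>\<^sup>+\<omega> \<in> {\<omega> \<in> \<Lambda>. T \<omega> < \<top>}.
         emeasure (P (X (enn2real (T \<omega>)) \<omega>)) (X s -` A \<inter> space M) \<partial>P x)"
    and quasi_left_continuous: "x \<in> S \<Longrightarrow> (\<And>n. stopping_time F (T_seq n)) \<Longrightarrow>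
      (\<And>\<omega>. \<omega> \<in> space M \<Longrightarrow> incseq (\<lambda>n. T_seq n \<omega>)) \<Longrightarrow>
      AE \<omega> in P x. (SUP n. T_seq n \<omega>) < \<top> \<longrightarrow>
        (\<lambda>n. X (enn2real (T_seq n \<omega>)) \<omega>) \<longlonglongrightarrow> X (enn2real (SUP n. T_seq n \<omega>)) \<omega>"

definition exit_time :: "(real \<Rightarrow> 'w \<Rightarrow> 'a) \<Rightarrow> 'a set \<Rightarrow> 'w \<Rightarrow> ennreal" where
  "exit_time X A \<omega> = Inf {ennreal t | t. 0 < t \<and> X t \<omega> \<notin> A}"

text \<open>\<open>approximating_form X P u t\<close> is \<open>(u - P\<^sub>t u, u) / t\<close>, where \<open>P\<^sub>t\<close> is the transition semigroup
  of the process. The Dirichlet form of the process on \<open>L\<^sup>2\<close> has as domain the functions for which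
  this has a finite limit as \<open>t\<close> decreases to 0, and as value that limit. We integrate
  against \<open>lebesgue\<close>, not \<open>lborel\<close>, because the measures \<open>P x\<close> are only specified for \<open>x\<close>
  outside a Lebesgue null set.\<close>

definition approximating_form ::
  "(real \<Rightarrow> 'w \<Rightarrow> 'a) \<Rightarrow> ('a \<Rightarrow> 'w measure) \<Rightarrow> ('a::euclidean_space \<Rightarrow> real) \<Rightarrow> real \<Rightarrow> real"
  where
  "approximating_form X P u t =
    (1 / t) * (LINT x|lebesgue. (u x - (LINT \<omega>|P x. u (X t \<omega>))) * u x)"

definition associated_with_form ::
  "('a::euclidean_space \<Rightarrow> 'a \<Rightarrow> real) \<Rightarrow> (real \<Rightarrow> 'w \<Rightarrow> 'a) \<Rightarrow> ('a \<Rightarrow> 'w measure) \<Rightarrow> bool" where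
  "associated_with_form J X P \<longleftrightarrow>
    (\<forall>u \<in> square_integrable.
       (u \<in> form_domain J \<longleftrightarrow> (\<exists>l. (approximating_form X P u \<longlongrightarrow> l) (at_right 0))) \<and>
       (u \<in> form_domain J \<longrightarrow>
          (approximating_form X P u \<longlongrightarrow> enn2real (energy J u)) (at_right 0)))"

section \<open>Transition densities\<close>

definition symmetric_transition_density ::
  "'a::euclidean_space set \<Rightarrow> 'w measure \<Rightarrow> (real \<Rightarrow> 'w \<Rightarrow> 'a) \<Rightarrow> ('a \<Rightarrow> 'w measure) \<Rightarrow>
    (real \<Rightarrow> 'a \<Rightarrow> 'a \<Rightarrow> real) \<Rightarrow> bool" where
  "symmetric_transition_density S M X P p \<longleftrightarrow>
    (\<forall>t>0. \<forall>x\<in>S.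
       p t x \<in> borel_measurable (restrict_space borel S) \<and>
       (\<forall>y\<in>S. 0 \<le> p t x y \<and> p t x y = p t y x) \<and>
       (\<forall>A\<in>sets borel. emeasure (P x) (X t -` A \<inter> space M) =
          (\<integral>\<^sup>+y \<in> A \<inter> S. ennreal (p t x y) \<partial>lebesgue)))"

text \<open>Exit times are measurable only after completion of the measures \<open>P x\<close>.\<close>

definition killed_transition_density ::
  "'a::euclidean_space set \<Rightarrow> 'w measure \<Rightarrow> (real \<Rightarrow> 'w \<Rightarrow> 'a) \<Rightarrow> ('a \<Rightarrow> 'w measure) \<Rightarrow>
    'a set \<Rightarrow> (real \<Rightarrow> 'a \<Rightarrow> 'a \<Rightarrow> real) \<Rightarrow> bool" where
  "killed_transition_density S M X P D q \<longleftrightarrow>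
    (\<forall>t>0. \<forall>x\<in>D \<inter> S.
       q t x \<in> borel_measurable (restrict_space borel (D \<inter> S)) \<and>
       (\<forall>y\<in>D \<inter> S. 0 \<le> q t x y) \<and>
       (\<forall>A\<in>sets borel.
          emeasure (completion (P x)) {\<omega> \<in> space M. X t \<omega> \<in> A \<and> ennreal t < exit_time X D \<omega>} =
          (\<integral>\<^sup>+y \<in> A \<inter> (D \<inter> S). ennreal (q t x y) \<partial>lebesgue)))"

definition cube :: "'a::euclidean_space \<Rightarrow> real \<Rightarrow> 'a set" where
  "cube x r = {y. \<forall>b\<in>Basis. \<bar>(y - x) \<bullet> b\<bar> < r / 2}"

text \<open>The expected time spent in \<open>B\<close> before leaving \<open>A\<close>, for the process started at \<open>x\<close>.\<close>

definition expected_occupation_time ::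
  "(real \<Rightarrow> 'w \<Rightarrow> 'a) \<Rightarrow> ('a \<Rightarrow> 'w measure) \<Rightarrow> 'a \<Rightarrow> 'a set \<Rightarrow> 'a set \<Rightarrow> ennreal" where
  "expected_occupation_time X P x A B =
    (\<integral>\<^sup>+\<omega>. (\<integral>\<^sup>+s \<in> {s. 0 \<le> s \<and> ennreal s < exit_time X A \<omega>}. indicator B (X s \<omega>) \<partial>lborel)
      \<partial>completion (P x))"

end

theory Submission
  imports Defs
begin

text \<open>Fix \<open>\<beta>\<close> and shrink \<open>Q(x\<^sub>0,R)\<close> to a concentric cube \<open>Q'\<close> so close to it that \<open>B \<inter> Q'\<close> still has
  half of the minimal measure \<open>\<beta> R^d\<close>. Any two points of \<open>Q'\<close> are joined by a segment, which is
  covered by a number \<open>n\<close> (depending on \<open>\<beta>\<close> and \<open>R\<close> only) of small balls, all inside a closed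
  set \<open>K \<subseteq> Q(x\<^sub>0,R)\<close>. For a time \<open>s = n h\<close> with \<open>h \<in> [1/4, 1]\<close>, the Markov property at the times
  \<open>h, 2h, \<dots>\<close> and the lower bound (iii) in each ball show that \<open>X\<close> is in \<open>A\<close> at time \<open>s\<close>, without having
  left \<open>K\<close>, with probability at least \<open>c \<bar>A\<bar>\<close>, first for \<open>A\<close> in a small ball and then, by
  countable additivity, for all \<open>A \<subseteq> Q'\<close>. Integrating over \<open>s \<in> [n/4, n]\<close> bounds the occupation
  time from below, uniformly over all \<open>B\<close> with \<open>\<bar>B\<bar> \<ge> \<beta> R^d\<close>; taking the infimum over these \<open>B\<close>
  makes the bound monotone in \<open>\<beta>\<close>.

  Only one-time marginals occur in the strong Markov property, so the event of not leaving \<open>K\<close> is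
  treated as the limit of the events that \<open>X\<close> is in \<open>K\<close> at the points of a grid. That limit event is
  also measurable without completion, unlike the exit time.\<close>

section \<open>Exceptional sets are Lebesgue null\<close>

text \<open>A competitor u for an open set G is at least 1 almost everywhere on G, so the measure of
  G is at most the squared L2 norm of u, which is part of \<open>energy1 J u\<close>. Hence
  \<open>N\<close> lies in open sets of arbitrarily small measure. \<open>N\<close> itself need not
  be Borel; it is contained in a Borel null set, which is why the conclusion is about
  \<open>lebesgue\<close>.\<close>

lemma capacity_zero_null_sets:
  fixes N :: "'a::euclidean_space set"
  assumes "capacity J N = 0"
  shows "N \<in> null_sets lebesgue"
proof -
  have "\<exists>G. open G \<and> N \<subseteq> G \<and> emeasure lborel G < ennreal e" if "0 < e" for e
  proof -
    have "capacity J N < ennreal e"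
      using assms that by simp
    then obtain G u where G: "open G" "N \<subseteq> G" and u: "u \<in> form_domain J"
      "AE x in lborel. x \<in> G \<longrightarrow> 1 \<le> u x" "energy1 J u < ennreal e"
      unfolding capacity_def INF_less_iff by blast
    have "emeasure lborel G = (\<integral>\<^sup>+x. indicator G x \<partial>lborel)"
      using G by simp
    also have "\<dots> \<le> (\<integral>\<^sup>+x. ennreal ((u x)\<^sup>2) \<partial>lborel)"
    proof (rule nn_integral_mono_AE)
      show "AE x in lborel. indicator G x \<le> ennreal ((u x)\<^sup>2)"
        using u(2) by eventually_elim (auto simp: indicator_def one_le_power ennreal_le_iff2 simp flip: ennreal_1)
    qed
    also have "\<dots> \<le> energy1 J u"
      by (simp add: energy1_def)
    finally show ?thesis
      using G u(3) by auto
  qed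
  then have "\<forall>n. \<exists>G. open G \<and> N \<subseteq> G \<and> emeasure lborel G < ennreal (1 / Suc n)"
    by simp
  then obtain G where G: "\<And>n. open (G n)" "\<And>n. N \<subseteq> G n"
    "\<And>n. emeasure lborel (G n) < ennreal (1 / Suc n)"
    by metis
  have m[measurable]: "G n \<in> sets borel" for n
    using G(1) by simp
  have "emeasure lborel (\<Inter>n. G n) \<le> 0"
  proof (rule ennreal_le_epsilon)
    fix e :: real assume "0 < e"
    then obtain n where "1 / Suc n < e"
      using nat_approx_posE by auto
    have "emeasure lborel (\<Inter>n. G n) \<le> emeasure lborel (G n)"
      by (intro emeasure_mono) auto
    also have "\<dots> \<le> ennreal (1 / Suc n)"
      using G(3) less_imp_le by blast
    also have "\<dots> \<le> ennreal e"
      using \<open>1 / Suc n < e\<close> by (intro ennreal_leI) simp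
    finally show "emeasure lborel (\<Inter>n. G n) \<le> 0 + ennreal e"
      by simp
  qed
  then have "(\<Inter>n. G n) \<in> null_sets lborel"
    by (intro null_setsI) auto
  then show ?thesis
    using G(2) by (intro null_sets_completion_subset[of N "\<Inter>n. G n"]) (auto intro: null_sets_completionI)
qed

section \<open>Transition kernels and the Markov property at fixed times\<close>

context conservative_hunt_process
begin

abbreviation "state_space \<equiv> restrict_space borel S"

text \<open>The measures live on the trace of the Borel sets on \<open>S\<close>, because
  \<open>P x\<close> is specified only for x in \<open>S\<close>; in this form they are a kernel
  from \<open>state_space\<close> to itself and can be composed with \<open>bind\<close>.\<close>

definition transition_kernel :: "real \<Rightarrow> 'a \<Rightarrow> 'a measure" where
  "transition_kernel t x = distr (P x) state_space (X t)"

lemma space_P: "x \<in> S \<Longrightarrow> space (P x) = space M"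
  using sets_P by (rule sets_eq_imp_space_eq)

lemma space_F: "space (F t) = space M"
  using filtration_F by (rule filtration.space_F)

lemma measurable_X_F [measurable]: "0 \<le> t \<Longrightarrow> X t \<in> measurable (F (ennreal t)) state_space"
  by (intro measurable_restrict_space2 adapted_X) (auto simp: space_F X_in_S)

lemma sets_F_mono: "s \<le> t \<Longrightarrow> sets (F s) \<subseteq> sets (F t)"
  using filtration_F by (rule filtration.sets_F_mono)

lemma measurable_X_F_mono:
  assumes "0 \<le> s" "s \<le> t" shows "X s \<in> measurable (F (ennreal t)) state_space"
proof -
  have "sets (F (ennreal s)) \<subseteq> sets (F (ennreal t))"
    using assms by (intro sets_F_mono ennreal_leI)
  with measurable_X_F[OF assms(1)] show ?thesis
    by (auto simp: measurable_def space_F)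
qed

lemma measurable_X_M [measurable]:
  assumes "0 \<le> t" shows "X t \<in> measurable M state_space"
  using measurable_X_F[OF assms] by (auto simp: measurable_def space_F intro: subsetD[OF sets_F])

lemma borel_measurable_X [measurable]: "0 \<le> t \<Longrightarrow> X t \<in> borel_measurable M"
  using measurable_X_M by (rule measurable_restrict_space2_iff[THEN iffD1, THEN conjunct1])

lemma measurable_X_P [measurable]: "0 \<le> t \<Longrightarrow> x \<in> S \<Longrightarrow> X t \<in> measurable (P x) state_space"
  using measurable_X_M[of t] measurable_cong_sets[OF sets_P refl, of x state_space] by simp

lemma measurable_transition_kernel [measurable]:
  assumes "0 \<le> t" shows "transition_kernel t \<in> measurable state_space (subprob_algebra state_space)"
proof (rule measurable_subprob_algebra)
  fix x assume "x \<in> space state_space"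
  then have x: "x \<in> S"
    by (simp add: space_restrict_space)
  then interpret prob_space "P x"
    by (rule prob_space_P)
  show "subprob_space (transition_kernel t x)"
    unfolding transition_kernel_def using x assms
    by (intro subprob_space_distr) (auto simp: space_restrict_space intro: measurable_X_P)
  show "sets (transition_kernel t x) = sets state_space"
    by (simp add: transition_kernel_def)
next
  fix A assume A: "A \<in> sets state_space"
  then obtain A' where A': "A' \<in> sets borel" "A = A' \<inter> S"
    by (auto simp: sets_restrict_space)
  have "emeasure (transition_kernel t x) A = emeasure (P x) (X t -` A' \<inter> space M)"
    if "x \<in> space state_space" for x
  proof -
    have "x \<in> S"
      using that by (simp add: space_restrict_space)
    then show ?thesis
      unfolding transition_kernel_def using A assms X_in_S
      by (subst emeasure_distr) (auto simp: space_P A'(2) intro!: arg_cong2[where f=emeasure])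
  qed
  then show "(\<lambda>x. emeasure (transition_kernel t x) A) \<in> borel_measurable state_space"
    using measurable_P[OF assms A'(1)] by (subst measurable_cong) auto
qed

text \<open>The strong Markov property at a constant time compares two measures on \<open>S\<close>:
  the law of the position at time t + s under \<open>P x\<close> restricted to \<Lambda>, and the
  law at time t under the same restriction, followed by the kernel for time s. Once these measures
  agree on sets, integrals of all nonnegative f agree.\<close>

lemma markov_property:
  assumes x: "x \<in> S" and t: "0 \<le> t" and s: "0 \<le> s" and \<Lambda>: "\<Lambda> \<in> sets (F (ennreal t))"
    and f: "f \<in> borel_measurable state_space"
  shows "(\<integral>\<^sup>+\<omega>. indicator \<Lambda> \<omega> * f (X (t + s) \<omega>) \<partial>P x) =
    (\<integral>\<^sup>+\<omega>. indicator \<Lambda> \<omega> * (\<integral>\<^sup>+\<omega>'. f (X s \<omega>') \<partial>P (X t \<omega>)) \<partial>P x)"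
proof -
  have \<Lambda>P[measurable]: "\<Lambda> \<in> sets (P x)" and \<Lambda>M: "\<Lambda> \<in> sets M"
    using \<Lambda> sets_F sets_P[OF x] by auto
  note [measurable] = f measurable_X_P[OF t x] measurable_X_P[OF add_nonneg_nonneg[OF t s] x]
    measurable_transition_kernel[OF s]
  let ?\<mu> = "density (P x) (indicator \<Lambda>)"
  have st: "stopping_time F (\<lambda>_. ennreal t)"
    by (rule stopping_time_const)
  have pre: "\<Lambda> \<in> sets (filtration.pre_sigma (space M) F (\<lambda>_. ennreal t))"
  proof (intro filtration.sets_pre_sigmaI[OF filtration_F st])
    fix r
    show "{\<omega> \<in> \<Lambda>. ennreal t \<le> r} \<in> sets (F r)"
      using \<Lambda> sets_F_mono by (cases "ennreal t \<le> r") auto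
  qed
  \<comment> \<open>On an empty space \<open>bind\<close> takes a default value, so nonemptiness has
    to be known before it is unfolded.\<close>
  have ne: "S \<noteq> {}" "space M \<noteq> {}"
    using x prob_space.not_empty[OF prob_space_P[OF x]] by (auto simp: space_P)
  have eq: "distr ?\<mu> state_space (X (t + s)) =
    bind (distr ?\<mu> state_space (X t)) (transition_kernel s)"
  proof (rule measure_eqI)
    show "sets (distr ?\<mu> state_space (X (t + s))) =
        sets (bind (distr ?\<mu> state_space (X t)) (transition_kernel s))"
      using ne
      by (subst sets_bind[of _ _ state_space]) (auto simp: transition_kernel_def space_restrict_space)
  next
    fix A assume "A \<in> sets (distr ?\<mu> state_space (X (t + s)))"
    then have A[measurable]: "A \<in> sets state_space"
      by simp
    then obtain A' where A': "A' \<in> sets borel" "A = A' \<inter> S"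
      by (auto simp: sets_restrict_space)
    have "emeasure (distr ?\<mu> state_space (X (t + s))) A =
        emeasure (P x) (\<Lambda> \<inter> (X (t + s) -` A \<inter> space (P x)))"
      by (subst emeasure_distr; simp add: emeasure_density)
         (auto intro!: arg_cong2[where f=emeasure] simp: indicator_inter_arith[symmetric]
           simp flip: nn_integral_indicator)
    also have "\<Lambda> \<inter> (X (t + s) -` A \<inter> space (P x)) =
        {\<omega> \<in> \<Lambda>. ennreal t < \<top> \<and> X (enn2real (ennreal t) + s) \<omega> \<in> A'}"
      using sets.sets_into_space[OF \<Lambda>M] X_in_S t s by (auto simp: A'(2) space_P[OF x])
    also have "emeasure (P x) \<dots> = (\<integral>\<^sup>+\<omega> \<in> {\<omega> \<in> \<Lambda>. ennreal t < \<top>}.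
         emeasure (P (X (enn2real (ennreal t)) \<omega>)) (X s -` A' \<inter> space M) \<partial>P x)"
      by (rule strong_markov[OF x st pre s A'(1)])
    also have "\<dots> = (\<integral>\<^sup>+\<omega>. indicator \<Lambda> \<omega> * emeasure (transition_kernel s (X t \<omega>)) A \<partial>P x)"
    proof (rule nn_integral_cong)
      fix \<omega> assume "\<omega> \<in> space (P x)"
      then have "X t \<omega> \<in> S"
        using X_in_S t by (simp add: space_P[OF x])
      moreover then have "emeasure (transition_kernel s (X t \<omega>)) A =
          emeasure (P (X t \<omega>)) (X s -` A' \<inter> space M)"
        unfolding transition_kernel_def using s A X_in_S
        by (subst emeasure_distr) (auto simp: space_P A'(2) intro!: arg_cong2[where f=emeasure])
      ultimately show "emeasure (P (X (enn2real (ennreal t)) \<omega>)) (X s -` A' \<inter> space M) *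
          indicator {\<omega> \<in> \<Lambda>. ennreal t < \<top>} \<omega> =
          indicator \<Lambda> \<omega> * emeasure (transition_kernel s (X t \<omega>)) A"
        using t by (simp add: mult.commute)
    qed
    also have "\<dots> = emeasure (bind (distr ?\<mu> state_space (X t)) (transition_kernel s)) A"
      using ne
      by (subst emeasure_bind[of _ _ state_space])
        (auto simp: space_restrict_space nn_integral_distr nn_integral_density
          measurable_emeasure_subprob_algebra)
    finally show "emeasure (distr ?\<mu> state_space (X (t + s))) A =
      emeasure (bind (distr ?\<mu> state_space (X t)) (transition_kernel s)) A" .
  qed
  have "(\<integral>\<^sup>+\<omega>. indicator \<Lambda> \<omega> * f (X (t + s) \<omega>) \<partial>P x) =
      (\<integral>\<^sup>+y. f y \<partial>distr ?\<mu> state_space (X (t + s)))"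
    by (simp add: nn_integral_distr nn_integral_density)
  also have "\<dots> = (\<integral>\<^sup>+y. (\<integral>\<^sup>+z. f z \<partial>transition_kernel s y) \<partial>distr ?\<mu> state_space (X t))"
    unfolding eq by (rule nn_integral_bind[of _ state_space]) auto
  also have "\<dots> = (\<integral>\<^sup>+\<omega>. indicator \<Lambda> \<omega> * (\<integral>\<^sup>+z. f z \<partial>transition_kernel s (X t \<omega>)) \<partial>P x)"
    by (simp add: nn_integral_distr nn_integral_density)
  also have "\<dots> = (\<integral>\<^sup>+\<omega>. indicator \<Lambda> \<omega> * (\<integral>\<^sup>+\<omega>'. f (X s \<omega>') \<partial>P (X t \<omega>)) \<partial>P x)"
    using t s X_in_S
    by (intro nn_integral_cong)
       (simp add: transition_kernel_def nn_integral_distr space_P[OF x])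
  finally show ?thesis .
qed

section \<open>The process observed on a time grid\<close>

definition restricted_transition :: "'a set \<Rightarrow> real \<Rightarrow> ('a \<Rightarrow> ennreal) \<Rightarrow> 'a \<Rightarrow> ennreal" where
  "restricted_transition K h f x = (\<integral>\<^sup>+\<omega>. indicator K (X h \<omega>) * f (X h \<omega>) \<partial>P x)"

text \<open>Time 0 is left out, to match \<open>restricted_transition\<close>, which tests only the
  endpoint of a step, and \<open>exit_time\<close>, which ignores time 0.\<close>

definition skeleton_event :: "'a set \<Rightarrow> real \<Rightarrow> nat \<Rightarrow> 'w set" where
  "skeleton_event K h n = {\<omega> \<in> space M. \<forall>i\<in>{1..n}. X (real i * h) \<omega> \<in> K}"

lemma measurable_restricted_transition:
  assumes h: "0 \<le> h" and K: "K \<in> sets borel" and f: "f \<in> borel_measurable state_space"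
  shows "restricted_transition K h f \<in> borel_measurable state_space"
proof -
  note [measurable] = h f measurable_transition_kernel[OF h]
  have K'[measurable]: "indicator K \<in> borel_measurable state_space"
    using K by (intro measurable_restrict_space1) auto
  have "(\<lambda>x. \<integral>\<^sup>+y. indicator K y * f y \<partial>transition_kernel h x) \<in> borel_measurable state_space"
    by measurable
  also have "?this \<longleftrightarrow> ?thesis"
    using h by (intro measurable_cong)
      (simp add: transition_kernel_def restricted_transition_def nn_integral_distr
        space_restrict_space)
  finally show ?thesis .
qed

lemma measurable_restricted_transition_funpow:
  assumes "0 \<le> h" "K \<in> sets borel" "f \<in> borel_measurable state_space"
  shows "(restricted_transition K h ^^ n) f \<in> borel_measurable state_space"
  using assms by (induction n) (auto intro: measurable_restricted_transition)

lemma skeleton_event_sets_F: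
  assumes h: "0 \<le> h" and K: "K \<in> sets borel"
  shows "skeleton_event K h n \<in> sets (F (ennreal (real n * h)))"
proof -
  have "{\<omega> \<in> space M. X (real i * h) \<omega> \<in> K} \<in> sets (F (ennreal (real n * h)))" if "i \<in> {1..n}" for i
  proof -
    have "X (real i * h) \<in> measurable (F (ennreal (real n * h))) state_space"
      using that h by (intro measurable_X_F_mono mult_right_mono) auto
    then have "X (real i * h) \<in> borel_measurable (F (ennreal (real n * h)))"
      by (rule measurable_restrict_space2_iff[THEN iffD1, THEN conjunct1])
    from measurable_sets[OF this K] show ?thesis
      by (simp add: vimage_def space_F Int_def conj_commute)
  qed
  then have "{\<omega> \<in> space (F (ennreal (real n * h))). \<forall>i\<in>{1..n}. X (real i * h) \<omega> \<in> K} \<in>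
      sets (F (ennreal (real n * h)))"
    by (intro sets.sets_Collect_finite_All) (auto simp: space_F)
  then show ?thesis
    by (simp add: skeleton_event_def space_F)
qed

text \<open>Induction that splits off the last grid step: the innermost application of the operator
  is the step from n h to (n + 1) h, and the Markov property at time n h merges it with the event
  for the first n grid points. This requires f to vary in the induction.\<close>

lemma skeleton_formula:
  assumes x: "x \<in> S" and h: "0 \<le> h" and K: "K \<in> sets borel"
    and f: "f \<in> borel_measurable state_space"
  shows "(restricted_transition K h ^^ n) f x =
    (\<integral>\<^sup>+\<omega>. indicator (skeleton_event K h n) \<omega> * f (X (real n * h) \<omega>) \<partial>P x)"
  using f
proof (induction n arbitrary: f)
  case 0
  interpret prob_space "P x"
    using x by (rule prob_space_P)
  \<comment> \<open>For n = 0 no grid time is tested, so the event is the whole space, and the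
    process starts at x almost surely.\<close>
  have "(\<integral>\<^sup>+\<omega>. indicator (skeleton_event K h 0) \<omega> * f (X (real 0 * h) \<omega>) \<partial>P x) =
      (\<integral>\<^sup>+\<omega>. f x \<partial>P x)"
    using normal[OF x] AE_space
    by (intro nn_integral_cong_AE, eventually_elim) (auto simp: skeleton_event_def space_P[OF x])
  then show ?case
    by (simp add: emeasure_space_1)
next
  case (Suc n)
  have K'[measurable]: "indicator K \<in> borel_measurable state_space"
    using K by (intro measurable_restrict_space1) auto
  note [measurable] = Suc.prems
  have "(restricted_transition K h ^^ Suc n) f x =
      (restricted_transition K h ^^ n) (restricted_transition K h f) x"
    by (simp only: funpow_Suc_right o_apply)
  also have "\<dots> = (\<integral>\<^sup>+\<omega>. indicator (skeleton_event K h n) \<omega> *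
      (\<integral>\<^sup>+\<omega>'. indicator K (X h \<omega>') * f (X h \<omega>') \<partial>P (X (real n * h) \<omega>)) \<partial>P x)"
    by (subst Suc.IH[OF measurable_restricted_transition[OF h K Suc.prems]])
      (simp add: restricted_transition_def)
  also have "\<dots> = (\<integral>\<^sup>+\<omega>. indicator (skeleton_event K h n) \<omega> *
      (indicator K (X (real n * h + h) \<omega>) * f (X (real n * h + h) \<omega>)) \<partial>P x)"
    using x h K
    by (intro markov_property[where f="\<lambda>y. indicator K y * f y", symmetric] skeleton_event_sets_F)
      auto
  also have "\<dots> = (\<integral>\<^sup>+\<omega>. indicator (skeleton_event K h (Suc n)) \<omega> *
      f (X (real (Suc n) * h) \<omega>) \<partial>P x)"
    by (intro nn_integral_cong)
      (auto simp: skeleton_event_def space_P[OF x] atLeastAtMostSuc_conv algebra_simps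
        split: split_indicator)
  finally show ?case .
qed


section \<open>Confinement to a closed set and occupation times\<close>

definition confined :: "'a set \<Rightarrow> 'a set \<Rightarrow> real \<Rightarrow> 'w set" where
  "confined K B s = {\<omega> \<in> space M. (\<forall>t\<in>{0<..<s}. X t \<omega> \<in> K) \<and> X s \<omega> \<in> B}"

lemma right_continuous_eventually:
  assumes "\<omega> \<in> space M" "0 \<le> t" "open G" "X t \<omega> \<in> G"
  obtains b where "t < b" "\<And>r. t < r \<Longrightarrow> r < b \<Longrightarrow> X r \<omega> \<in> G"
proof -
  have "\<forall>\<^sub>F r in at_right t. X r \<omega> \<in> G"
    using right_continuous_X[OF assms(1,2)] assms(3,4) by (rule topological_tendstoD)
  then show ?thesis
    using that unfolding eventually_at_right_field by blast
qed

text \<open>If the path were outside K at time t, then by right-continuity and openness of the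
  complement it would stay outside on an interval to the right of t, which contains one of the given
  times.\<close>

lemma in_closed_if_dense:
  assumes \<omega>: "\<omega> \<in> space M" and K: "closed K"
    and D: "\<And>a b. 0 < a \<Longrightarrow> a < b \<Longrightarrow> b \<le> s \<Longrightarrow> \<exists>d. a < d \<and> d < b \<and> X d \<omega> \<in> K"
    and t: "0 < t" "t < s"
  shows "X t \<omega> \<in> K"
proof (rule ccontr)
  assume "X t \<omega> \<notin> K"
  then obtain b where b: "t < b" "\<And>r. t < r \<Longrightarrow> r < b \<Longrightarrow> X r \<omega> \<in> - K"
    using right_continuous_eventually[OF \<omega>, of t "- K"] K t by auto
  from D[of t "min b s"] obtain d where "t < d" "d < min b s" "X d \<omega> \<in> K"
    using b(1) t by auto
  with b(2)[of d] show False
    by auto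
qed

lemma confined_rational:
  assumes "closed K"
  shows "confined K B s = {\<omega> \<in> space M.
    (\<forall>q::rat. 0 < q \<longrightarrow> real_of_rat q < s \<longrightarrow> X (real_of_rat q) \<omega> \<in> K) \<and> X s \<omega> \<in> B}"
proof -
  have "X t \<omega> \<in> K" if "\<omega> \<in> space M" "0 < t" "t < s"
    and q: "\<forall>q::rat. 0 < q \<longrightarrow> real_of_rat q < s \<longrightarrow> X (real_of_rat q) \<omega> \<in> K" for \<omega> t
  proof (rule in_closed_if_dense[OF that(1) assms _ that(2,3)])
    fix a b :: real assume ab: "0 < a" "a < b" "b \<le> s"
    obtain q where "a < real_of_rat q" "real_of_rat q < b"
      using of_rat_dense[OF ab(2)] by blast
    moreover then have "0 < q"
      using ab by (metis less_trans zero_less_of_rat_iff)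
    ultimately show "\<exists>d. a < d \<and> d < b \<and> X d \<omega> \<in> K"
      using q ab by (intro exI[of _ "real_of_rat q"]) auto
  qed
  then show ?thesis
    by (auto simp: confined_def)
qed

text \<open>Strictness comes from right-continuity at s: the position at time s lies in the open set
  Q, so the path remains in Q until some b > s.\<close>

lemma confined_exit_time:
  assumes \<omega>: "\<omega> \<in> confined K B s" and s: "0 < s"
    and sub: "K \<subseteq> Q" "B \<subseteq> Q" and Q: "open Q"
  shows "ennreal s < exit_time X Q \<omega>"
proof -
  have "\<omega> \<in> space M" "X s \<omega> \<in> Q"
    using \<omega> sub by (auto simp: confined_def)
  then obtain b where b: "s < b" "\<And>r. s < r \<Longrightarrow> r < b \<Longrightarrow> X r \<omega> \<in> Q"
    using right_continuous_eventually[of \<omega> s Q] Q s by auto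
  have "b \<le> t" if "0 < t" "X t \<omega> \<notin> Q" for t
  proof (rule ccontr)
    assume "\<not> b \<le> t"
    then have "X t \<omega> \<in> Q"
      using \<omega> sub b(2)[of t] that(1) unfolding confined_def
      by (cases t s rule: linorder_cases) auto
    with that show False
      by simp
  qed
  then have "ennreal b \<le> exit_time X Q \<omega>"
    unfolding exit_time_def by (intro Inf_greatest) (auto intro: ennreal_leI)
  moreover have "ennreal s < ennreal b"
    using b(1) s by (simp add: ennreal_less_iff)
  ultimately show ?thesis
    by simp
qed

text \<open>The process is a pointwise limit of processes that are constant in time on grid cells,
  each jointly measurable because it takes countably many time values. Truncation at 0 makes the map
  meaningful for negative s, where nothing is known about \<open>X\<close>.\<close>

lemma measurable_X_joint:
  "(\<lambda>(s, \<omega>). X (max 0 s) \<omega>) \<in> borel_measurable (borel \<Otimes>\<^sub>M M)"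
proof (rule borel_measurable_LIMSEQ_metric)
  \<comment> \<open>The summand 1 selects the right end of the grid cell, strictly after s, so that
    right-continuity yields the limit.\<close>
  define u where "u n s = real (nat \<lfloor>s * real (Suc n)\<rfloor> + 1) / real (Suc n)" for n and s :: real
  show "(\<lambda>(s, \<omega>). X (u n s) \<omega>) \<in> borel_measurable (borel \<Otimes>\<^sub>M M)" for n
  proof -
    have "(\<lambda>p. X (real (nat \<lfloor>fst p * real (Suc n)\<rfloor> + 1) / real (Suc n)) (snd p))
        \<in> borel_measurable (borel \<Otimes>\<^sub>M M)"
    proof (rule measurable_compose_countable[where g="\<lambda>p. nat \<lfloor>fst p * real (Suc n)\<rfloor>"
          and f="\<lambda>i p. X (real (i + 1) / real (Suc n)) (snd p)"])
      show "(\<lambda>p. X (real (i + 1) / real (Suc n)) (snd p)) \<in> borel_measurable (borel \<Otimes>\<^sub>M M)" for i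
        by (rule measurable_compose[OF measurable_snd borel_measurable_X]) simp
      show "(\<lambda>p. nat \<lfloor>fst p * real (Suc n)\<rfloor>) \<in> measurable (borel \<Otimes>\<^sub>M M) (count_space UNIV)"
        by measurable
    qed
    then show ?thesis
      by (simp add: u_def case_prod_beta')
  qed
  fix p :: "real \<times> 'w" assume "p \<in> space (borel \<Otimes>\<^sub>M M)"
  then obtain s \<omega> where p: "p = (s, \<omega>)" "\<omega> \<in> space M"
    by (auto simp: space_pair_measure)
  have bounds: "max 0 s < u n s \<and> u n s \<le> max 0 s + inverse (real (Suc n))" for n
  proof (cases "0 \<le> s")
    case True
    define k where "k = \<lfloor>s * real (Suc n)\<rfloor>"
    have "0 \<le> k" "real_of_int k \<le> s * real (Suc n)" "s * real (Suc n) < real_of_int k + 1"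
      using True by (auto simp: k_def)
    then have "s < (real_of_int k + 1) / real (Suc n)" "real_of_int k / real (Suc n) \<le> s"
      by (simp_all only: pos_less_divide_eq pos_divide_le_eq of_nat_0_less_iff zero_less_Suc)
    then show ?thesis
      using True \<open>0 \<le> k\<close> unfolding u_def k_def[symmetric]
      by (simp add: add_divide_distrib inverse_eq_divide)
  next
    \<comment> \<open>For negative s, \<open>nat\<close> cuts the floor to 0, so the approximating
      time is 1 / (n + 1), which tends to 0.\<close>
    case False
    then have "\<lfloor>s * real (Suc n)\<rfloor> \<le> 0"
      by (smt (verit) floor_le_zero mult_nonpos_nonneg of_nat_0_le_iff)
    then have "nat \<lfloor>s * real (Suc n)\<rfloor> = 0"
      by simp
    then show ?thesis
      using False unfolding u_def by (simp add: field_simps)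
  qed
  have "(\<lambda>n. u n s) \<longlonglongrightarrow> max 0 s"
  proof (rule tendsto_sandwich[where f="\<lambda>_. max 0 s"])
    show "(\<lambda>n. max 0 s + inverse (real (Suc n))) \<longlonglongrightarrow> max 0 s"
      using tendsto_add[OF tendsto_const LIMSEQ_inverse_real_of_nat] by simp
    show "\<forall>\<^sub>F n in sequentially. max 0 s \<le> u n s"
      "\<forall>\<^sub>F n in sequentially. u n s \<le> max 0 s + inverse (real (Suc n))"
      by (intro always_eventually allI bounds[THEN conjunct1, THEN less_imp_le]
          bounds[THEN conjunct2])+
  qed auto
  then have "filterlim (\<lambda>n. u n s) (at_right (max 0 s)) sequentially"
    using bounds[THEN conjunct1, THEN less_imp_neq, THEN not_sym] bounds[THEN conjunct1]
    by (simp only: filterlim_at greaterThan_iff) simp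
  then show "(\<lambda>n. case p of (s, \<omega>) \<Rightarrow> X (u n s) \<omega>) \<longlonglongrightarrow> (case p of (s, \<omega>) \<Rightarrow> X (max 0 s) \<omega>)"
    using filterlim_compose[OF right_continuous_X[OF p(2), of "max 0 s"]] by (simp add: p(1))
qed

lemma sets_confined:
  assumes "closed K" "B \<in> sets borel" "0 \<le> s"
  shows "confined K B s \<in> sets M"
proof -
  have [measurable]: "X s \<in> borel_measurable M" "K \<in> sets borel" "B \<in> sets borel"
    using borel_measurable_X[OF assms(3)] assms(1,2) by simp_all
  have [measurable]: "Measurable.pred M (\<lambda>\<omega>. 0 < q \<longrightarrow> real_of_rat q < s \<longrightarrow> X (real_of_rat q) \<omega> \<in> K)" for q
  proof (cases "0 < q")
    case True
    then have [measurable]: "X (real_of_rat q) \<in> borel_measurable M"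
      by (intro borel_measurable_X) simp
    show ?thesis
      by measurable
  qed auto
  show ?thesis
    unfolding confined_rational[OF assms(1)] by measurable
qed

text \<open>The confinement probabilities are integrated over s from a to b and the order of
  integration is exchanged. For a path confined up to s, the time s precedes the exit time and the
  path is in B, so s counts towards the occupation time.\<close>

lemma occupation_time_ge:
  assumes x: "x \<in> S" and K: "closed K" and Q: "open Q" "K \<subseteq> Q" and B: "B \<in> sets borel" "B \<subseteq> Q"
    and a: "0 < a" and c: "\<And>s. a \<le> s \<Longrightarrow> s \<le> b \<Longrightarrow> c \<le> emeasure (P x) (confined K B s)"
  shows "c * ennreal (b - a) \<le> expected_occupation_time X P x Q B"
proof -
  interpret prob_space "P x"
    using x by (rule prob_space_P)
  interpret pair_sigma_finite lborel "P x"
    by standard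
  define W where "W = {(s, \<omega>). a \<le> s \<and> s \<le> b \<and> \<omega> \<in> confined K B s}"
  have sP: "sets (borel \<Otimes>\<^sub>M P x) = sets (borel \<Otimes>\<^sub>M M)"
    using sets_P[OF x] by (rule sets_pair_measure_cong[OF refl])
  have W: "W \<in> sets (lborel \<Otimes>\<^sub>M P x)"
  proof -
    note [measurable] = measurable_X_joint B(1)
    have [measurable]: "K \<in> sets borel"
      using K by simp
    have [measurable]: "Measurable.pred (borel \<Otimes>\<^sub>M M)
        (\<lambda>p. 0 < q \<longrightarrow> real_of_rat q < fst p \<longrightarrow> X (real_of_rat q) (snd p) \<in> K)" for q
    proof (cases "0 < q")
      case True
      then have "X (real_of_rat q) \<in> borel_measurable M"
        by (intro borel_measurable_X) simp
      from measurable_compose[OF measurable_snd this] show ?thesis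
        by measurable
    qed auto
    have "W = {p \<in> space (borel \<Otimes>\<^sub>M M). a \<le> fst p \<and> fst p \<le> b \<and>
        (\<forall>q::rat. 0 < q \<longrightarrow> real_of_rat q < fst p \<longrightarrow> X (real_of_rat q) (snd p) \<in> K) \<and>
        (\<lambda>(s, \<omega>). X (max 0 s) \<omega>) p \<in> B}"
      using a by (auto simp: W_def confined_rational[OF K] space_pair_measure)
    also have "\<dots> \<in> sets (borel \<Otimes>\<^sub>M M)"
      by measurable
    finally show ?thesis
      by (simp add: sP cong: sets_pair_measure_cong)
  qed
  have "c * ennreal (b - a) \<le> (\<integral>\<^sup>+s. c * indicator {a..b} s \<partial>lborel)"
    by (cases "a \<le> b") (auto simp: nn_integral_cmult_indicator ennreal_neg)
  also have "\<dots> \<le> (\<integral>\<^sup>+s. (\<integral>\<^sup>+\<omega>. indicator W (s, \<omega>) \<partial>P x) \<partial>lborel)"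
  proof (rule nn_integral_mono)
    fix s
    have "c \<le> (\<integral>\<^sup>+\<omega>. indicator W (s, \<omega>) \<partial>P x)" if s: "s \<in> {a..b}"
    proof -
      have "(\<integral>\<^sup>+\<omega>. indicator W (s, \<omega>) \<partial>P x) = (\<integral>\<^sup>+\<omega>. indicator (confined K B s) \<omega> \<partial>P x)"
        using s by (intro nn_integral_cong) (auto simp: W_def split: split_indicator)
      also have "\<dots> = emeasure (P x) (confined K B s)"
        using sets_confined[OF K B(1), of s] s a sets_P[OF x] by simp
      finally show ?thesis
        using c[of s] s by simp
    qed
    then show "c * indicator {a..b} s \<le> (\<integral>\<^sup>+\<omega>. indicator W (s, \<omega>) \<partial>P x)"
      by (auto split: split_indicator)
  qed
  also have "\<dots> = (\<integral>\<^sup>+\<omega>. (\<integral>\<^sup>+s. indicator W (s, \<omega>) \<partial>lborel) \<partial>P x)"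
    using W by (intro Fubini'[symmetric]) simp
  \<comment> \<open>The right-hand integrand contains the exit time and may fail to be measurable
    without completion; the comparison only uses monotonicity of the integral.\<close>
  also have "\<dots> \<le> (\<integral>\<^sup>+\<omega>. (\<integral>\<^sup>+s \<in> {s. 0 \<le> s \<and> ennreal s < exit_time X Q \<omega>}.
      indicator B (X s \<omega>) \<partial>lborel) \<partial>P x)"
    using confined_exit_time[OF _ _ Q(2) B(2) Q(1)] a
    by (intro nn_integral_mono) (auto simp: W_def confined_def split: split_indicator)
  also have "\<dots> = expected_occupation_time X P x Q B"
    by (simp add: expected_occupation_time_def nn_integral_completion)
  finally show ?thesis .
qed


section \<open>Lower bounds by chaining killed densities\<close>

lemma exit_time_gt_imp:
  assumes "ennreal h < exit_time X D \<omega>" "0 < t" "t \<le> h"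
  shows "X t \<omega> \<in> D"
proof (rule ccontr)
  assume "X t \<omega> \<notin> D"
  then have "exit_time X D \<omega> \<le> ennreal t"
    unfolding exit_time_def using assms(2) by (intro Inf_lower) blast
  also have "\<dots> \<le> ennreal h"
    using assms(3) by (rule ennreal_leI)
  finally show False
    using assms(1) by simp
qed

lemma sets_X_vimage:
  assumes "0 \<le> t" "A \<in> sets borel" "x \<in> S"
  shows "{\<omega> \<in> space M. X t \<omega> \<in> A} \<in> sets (P x)"
proof -
  from measurable_sets[OF borel_measurable_X[OF assms(1)] assms(2)] show ?thesis
    by (simp add: sets_P[OF assms(3)] vimage_def Int_def conj_commute)
qed

lemma sets_skeleton_event:
  assumes "0 \<le> h" "K \<in> sets borel" "x \<in> S"
  shows "skeleton_event K h n \<in> sets (P x)"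
  using skeleton_event_sets_F[OF assms(1,2)] sets_F sets_P[OF assms(3)] by auto

lemma skeleton_formula_indicator:
  assumes x: "x \<in> S" and h: "0 \<le> h" and K: "K \<in> sets borel" and A: "A \<in> sets borel"
  shows "(restricted_transition K h ^^ n) (indicator A) x =
    emeasure (P x) {\<omega> \<in> skeleton_event K h n. X (real n * h) \<omega> \<in> A}"
proof -
  have "(restricted_transition K h ^^ n) (indicator A) x =
      (\<integral>\<^sup>+\<omega>. indicator (skeleton_event K h n) \<omega> * indicator A (X (real n * h) \<omega>) \<partial>P x)"
    using A by (intro skeleton_formula[OF x h K] measurable_restrict_space1) auto
  also have "\<dots> = (\<integral>\<^sup>+\<omega>. indicator {\<omega> \<in> skeleton_event K h n. X (real n * h) \<omega> \<in> A} \<omega> \<partial>P x)"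
    by (intro nn_integral_cong) (auto split: split_indicator)
  also have "\<dots> = emeasure (P x) {\<omega> \<in> skeleton_event K h n. X (real n * h) \<omega> \<in> A}"
  proof (rule nn_integral_indicator)
    have "{\<omega> \<in> skeleton_event K h n. X (real n * h) \<omega> \<in> A} =
        skeleton_event K h n \<inter> {\<omega> \<in> space M. X (real n * h) \<omega> \<in> A}"
      by (auto simp: skeleton_event_def)
    also have "\<dots> \<in> sets (P x)"
      using assms by (intro sets.Int sets_skeleton_event sets_X_vimage) auto
    finally show "{\<omega> \<in> skeleton_event K h n. X (real n * h) \<omega> \<in> A} \<in> sets (P x)" .
  qed
  finally show ?thesis .
qed

text \<open>A path that has not left D by time h is in D, hence in K, at every positive grid time up
  to h. The constant is the same for every k, so the grid may later be refined without loss.\<close>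

lemma killed_density_skeleton_bound:
  assumes null: "- S \<in> null_sets lebesgue"
    and killed: "killed_transition_density S M X P D q"
    and h: "0 < h" and K: "K \<in> sets borel" "D \<subseteq> K" and k: "0 < k"
    and lower: "\<And>y. y \<in> G \<inter> S \<Longrightarrow> c \<le> q h x y"
    and x: "x \<in> D \<inter> S" and A: "A \<in> sets borel" "A \<subseteq> G" and G: "G \<subseteq> D"
  shows "ennreal c * emeasure lborel A
    \<le> (restricted_transition K (h / real k) ^^ k) (indicator A) x"
proof -
  have S: "S \<in> sets lebesgue"
    using sets.compl_sets[of "- S" lebesgue] null by (simp add: null_setsD2 Diff_Compl)
  have AL: "A \<in> sets lebesgue"
    using A by auto
  let ?E = "{\<omega> \<in> space M. X h \<omega> \<in> A \<and> ennreal h < exit_time X D \<omega>}"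
  let ?E' = "{\<omega> \<in> skeleton_event K (h / real k) k. X h \<omega> \<in> A}"
  have E': "?E' \<in> sets (P x)"
  proof -
    have "?E' = skeleton_event K (h / real k) k \<inter> {\<omega> \<in> space M. X h \<omega> \<in> A}"
      by (auto simp: skeleton_event_def)
    also have "\<dots> \<in> sets (P x)"
      using h K x A by (intro sets.Int sets_skeleton_event sets_X_vimage) auto
    finally show ?thesis .
  qed
  \<comment> \<open>The density is given only on \<open>S\<close>; replacing A by its part in
    \<open>S\<close> costs nothing, since the complement of \<open>S\<close> is null.\<close>
  have "emeasure lborel A = emeasure lebesgue (A - (- S))"
    using emeasure_Diff_null_set[OF null AL] A by (simp del: Diff_Compl)
  also have "A - (- S) = A \<inter> S"
    by auto
  finally have "ennreal c * emeasure lborel A = (\<integral>\<^sup>+y. ennreal c * indicator (A \<inter> S) y \<partial>lebesgue)"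
    using S AL by (simp add: nn_integral_cmult_indicator)
  also have "\<dots> \<le> (\<integral>\<^sup>+y \<in> A \<inter> (D \<inter> S). ennreal (q h x y) \<partial>lebesgue)"
    using A G by (intro nn_integral_mono) (auto split: split_indicator intro!: ennreal_leI lower)
  also have "\<dots> = emeasure (completion (P x)) ?E"
    using killed h x A(1) unfolding killed_transition_density_def by auto
  \<comment> \<open>Monotonicity asks for measurability of the larger event only, and that one
    involves finitely many times.\<close>
  also have "\<dots> \<le> emeasure (completion (P x)) ?E'"
  proof (intro emeasure_mono)
    have "X (real i * (h / real k)) \<omega> \<in> K" if "\<omega> \<in> ?E" "i \<in> {1..k}" for \<omega> i
    proof -
      have "real i * h \<le> real k * h"
        using that h by (intro mult_right_mono) auto
      then have "real i * (h / real k) \<le> h"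
        using k by (simp add: field_simps)
      moreover have "0 < real i * (h / real k)"
        using that h k by simp
      ultimately show ?thesis
        using exit_time_gt_imp[of h D \<omega> "real i * (h / real k)"] that(1) K(2) by auto
    qed
    then show "?E \<subseteq> ?E'"
      by (auto simp: skeleton_event_def)
    show "?E' \<in> sets (completion (P x))"
      using E' by (rule sets_completionI_sets)
  qed
  also have "\<dots> = emeasure (P x) ?E'"
    using E' by simp
  also have "\<dots> = (restricted_transition K (h / real k) ^^ k) (indicator A) x"
    using h k K x A by (subst skeleton_formula_indicator) auto
  finally show ?thesis .
qed

text \<open>Induction that splits off the first stage: from x the set \<open>G 1\<close> is reached
  with weight at least c v, and from each point of it the induction hypothesis applies to the
  shifted sequence of sets. The n intermediate sets give the factors c v, and the last of the n + 1
  stages gives the factor with A.\<close>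

lemma skeleton_chain:
  assumes h: "0 \<le> h" and K: "K \<in> sets borel"
    and G: "\<And>i. G i \<in> sets borel" "\<And>i. v \<le> emeasure lborel (G i)"
    and step: "\<And>i y A. i \<le> n \<Longrightarrow> y \<in> G i \<inter> S \<Longrightarrow> A \<in> sets borel \<Longrightarrow> A \<subseteq> G (Suc i) \<Longrightarrow>
      c * emeasure lborel A \<le> (restricted_transition K h ^^ k) (indicator A) y"
    and x: "x \<in> G 0 \<inter> S" and A: "A \<in> sets borel" "A \<subseteq> G (Suc n)"
  shows "(c * v) ^ n * (c * emeasure lborel A)
    \<le> (restricted_transition K h ^^ (k * Suc n)) (indicator A) x"
  using G step x A
proof (induction n arbitrary: G x)
  case 0
  then show ?case by simp
next
  case (Suc n)
  let ?V = "restricted_transition K h ^^ k"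
  let ?f = "(restricted_transition K h ^^ (k * Suc n)) (indicator A)"
  let ?l = "(c * v) ^ n * (c * emeasure lborel A)"
  note x = Suc.prems(4)
  have ind: "indicator B \<in> borel_measurable state_space" if "B \<in> sets borel" for B
    using that by (intro measurable_restrict_space1) auto
  have l: "?l \<le> ?f y" if "y \<in> G 1 \<inter> S" for y
  proof (rule Suc.IH[of "\<lambda>i. G (Suc i)"])
    fix i y' A' assume "i \<le> n" "y' \<in> G (Suc i) \<inter> S" "A' \<in> sets borel" "A' \<subseteq> G (Suc (Suc i))"
    then show "c * emeasure lborel A' \<le> ?V (indicator A') y'"
      by (intro Suc.prems(3)) auto
  qed (use Suc.prems that in auto)
  have "(c * v) ^ Suc n * (c * emeasure lborel A) = ?l * (c * v)"
    by (simp add: algebra_simps)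
  also have "\<dots> \<le> ?l * ?V (indicator (G 1)) x"
  proof (rule mult_left_mono)
    have "c * v \<le> c * emeasure lborel (G 1)"
      by (rule mult_left_mono) (use Suc.prems in auto)
    also have "\<dots> \<le> ?V (indicator (G 1)) x"
      by (rule Suc.prems(3)[of 0]) (use Suc.prems in auto)
    finally show "c * v \<le> ?V (indicator (G 1)) x" .
  qed simp
  also have "\<dots> = ?l * (\<integral>\<^sup>+\<omega>. indicator (skeleton_event K h k) \<omega> *
      indicator (G 1) (X (real k * h) \<omega>) \<partial>P x)"
    using x Suc.prems(1)[of 1] by (subst skeleton_formula[OF _ h K]) (auto intro: ind)
  also have "\<dots> = (\<integral>\<^sup>+\<omega>. ?l * (indicator (skeleton_event K h k) \<omega> *
      indicator (G 1) (X (real k * h) \<omega>)) \<partial>P x)"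
  proof (rule nn_integral_cmult[symmetric])
    have [measurable]: "skeleton_event K h k \<in> sets (P x)"
      using sets_skeleton_event[OF h K] x by auto
    have "(\<lambda>\<omega>. indicator (G 1) (X (real k * h) \<omega>) :: ennreal) \<in> borel_measurable (P x)"
      using h x ind[OF Suc.prems(1)[of 1]] by (intro measurable_compose[OF measurable_X_P]) auto
    then show "(\<lambda>\<omega>. indicator (skeleton_event K h k) \<omega> *
      indicator (G 1) (X (real k * h) \<omega>) :: ennreal) \<in> borel_measurable (P x)"
      by measurable
  qed
  also have "\<dots> \<le> (\<integral>\<^sup>+\<omega>. indicator (skeleton_event K h k) \<omega> * ?f (X (real k * h) \<omega>) \<partial>P x)"
    using l X_in_S[of _ "real k * h"] h
    by (intro nn_integral_mono) (auto simp: skeleton_event_def split: split_indicator)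
  also have "\<dots> = ?V ?f x"
    using x h K A by (intro skeleton_formula[symmetric] measurable_restricted_transition_funpow ind) auto
  also have "\<dots> = (restricted_transition K h ^^ (k * Suc (Suc n))) (indicator A) x"
    by (simp only: mult_Suc_right[of k "Suc n"] funpow_add o_apply)
  finally show ?case .
qed

text \<open>Halving the mesh keeps all old grid times, so the grid events decrease. On their
  intersection the path is in K at a dense set of times, hence at all times before the end, and
  continuity from above preserves the bound.\<close>

lemma confined_skeleton_limit:
  assumes x: "x \<in> S" and K: "closed K" and A: "A \<in> sets borel" and h: "0 < h"
    and c: "\<And>m. c \<le> (restricted_transition K (h / real (2 ^ m)) ^^ (2 ^ m * Suc n)) (indicator A) x"
  shows "c \<le> emeasure (P x) (confined K A (real (Suc n) * h))"
proof -
  interpret prob_space "P x"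
    using x by (rule prob_space_P)
  have Kb: "K \<in> sets borel"
    using K by simp
  let ?s = "real (Suc n) * h"
  let ?E = "\<lambda>m. {\<omega> \<in> skeleton_event K (h / real (2 ^ m)) (2 ^ m * Suc n). X ?s \<omega> \<in> A}"
  have s: "real (2 ^ m * Suc n) * (h / real (2 ^ m)) = ?s" for m
    by (simp add: field_simps)
  have E: "?E m \<in> sets (P x)" for m
  proof -
    have "?E m = skeleton_event K (h / real (2 ^ m)) (2 ^ m * Suc n) \<inter> {\<omega> \<in> space M. X ?s \<omega> \<in> A}"
      by (auto simp: skeleton_event_def)
    also have "\<dots> \<in> sets (P x)"
      using h Kb x A by (intro sets.Int sets_skeleton_event sets_X_vimage) auto
    finally show ?thesis .
  qed
  have "?E (Suc m) \<subseteq> ?E m" for m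
  proof
    fix \<omega> assume \<omega>: "\<omega> \<in> ?E (Suc m)"
    have "X (real i * (h / real (2 ^ m))) \<omega> \<in> K" if "i \<in> {1..2 ^ m * Suc n}" for i
    proof -
      have "2 * i \<in> {1..2 ^ Suc m * Suc n}"
        using that by auto
      then have "X (real (2 * i) * (h / real (2 ^ Suc m))) \<omega> \<in> K"
        using \<omega> by (auto simp only: skeleton_event_def mem_Collect_eq)
      then show ?thesis
        by simp
    qed
    then show "\<omega> \<in> ?E m"
      using \<omega> by (auto simp: skeleton_event_def)
  qed
  then have dec: "decseq ?E"
    by (rule decseq_SucI)
  have "c \<le> emeasure (P x) (?E m)" for m
  proof -
    note c[of m]
    also have "(restricted_transition K (h / real (2 ^ m)) ^^ (2 ^ m * Suc n)) (indicator A) x =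
        emeasure (P x) (?E m)"
      using h Kb x A by (subst skeleton_formula_indicator) (auto simp only: s intro: divide_nonneg_nonneg)
    finally show ?thesis .
  qed
  then have "c \<le> (INF m. emeasure (P x) (?E m))"
    by (rule INF_greatest)
  also have "\<dots> = emeasure (P x) (\<Inter>m. ?E m)"
    using E dec by (intro INF_emeasure_decseq) auto
  also have "\<dots> \<le> emeasure (P x) (confined K A ?s)"
  proof (rule emeasure_mono)
    show "confined K A ?s \<in> sets (P x)"
      using sets_confined[OF K A, of ?s] h sets_P[OF x] by simp
    show "(\<Inter>m. ?E m) \<subseteq> confined K A ?s"
    proof
      fix \<omega> assume "\<omega> \<in> (\<Inter>m. ?E m)"
      then have \<omega>: "\<omega> \<in> ?E m" for m
        by blast
      then have \<omega>M: "\<omega> \<in> space M" "X ?s \<omega> \<in> A"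
        by (auto simp: skeleton_event_def)
      have "X t \<omega> \<in> K" if t: "0 < t" "t < ?s" for t
      proof (rule in_closed_if_dense[OF \<omega>M(1) K _ t])
        fix a b assume ab: "0 < a" "a < b" "b \<le> ?s"
        obtain m where m: "h / (b - a) < 2 ^ m"
          using real_arch_pow[of 2] by auto
        define g where "g = h / real (2 ^ m)"
        have g: "0 < g" "g < b - a"
          using m h ab by (auto simp: g_def field_simps)
        \<comment> \<open>This is the index of the first grid time strictly after a; as the mesh is
          less than b - a, that time is before b.\<close>
        define i where "i = nat (\<lfloor>a / g\<rfloor> + 1)"
        have "0 \<le> \<lfloor>a / g\<rfloor>"
          using ab g by simp
        then have i: "a / g < real i" "real i \<le> a / g + 1" "1 \<le> i"
          by (auto simp: i_def) linarith
        have d: "a < real i * g" "real i * g < b"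
        proof -
          show "a < real i * g"
            using i(1) g by (simp add: pos_divide_less_eq)
          have "real i * g \<le> (a / g + 1) * g"
            using i(2) g by (intro mult_right_mono) auto
          also have "\<dots> < b"
            using g by (simp add: algebra_simps)
          finally show "real i * g < b" .
        qed
        have "real i * g \<le> real (2 ^ m * Suc n) * g"
          using d ab s[of m] by (simp add: g_def)
        then have "i \<in> {1..2 ^ m * Suc n}"
          using g i(3) by (simp only: mult_le_cancel_right_pos of_nat_le_iff atLeastAtMost_iff)
        then have "X (real i * g) \<omega> \<in> K"
          using \<omega>[of m] by (auto simp only: skeleton_event_def mem_Collect_eq g_def)
        then show "\<exists>d. a < d \<and> d < b \<and> X d \<omega> \<in> K"
          using d by blast
      qed
      then show "\<omega> \<in> confined K A ?s"
        using \<omega>M by (auto simp: confined_def)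
    qed
  qed
  finally show ?thesis .
qed

text \<open>Three radii work together. Consecutive centres are at most r/4 apart, so the next ball
  of radius r/4 lies in the ball of radius r/2 about the current centre, where the density killed
  outside the ball of radius r is bounded below; this largest ball lies in K.\<close>

lemma confined_chain:
  fixes z :: "nat \<Rightarrow> 'a"
  assumes null: "- S \<in> null_sets lebesgue"
    and killed: "\<And>y. killed_transition_density S M X P (ball y r) (q (ball y r))"
    and lower: "\<And>y u w. u \<in> ball y (r / 2) \<inter> S \<Longrightarrow> w \<in> ball y (r / 2) \<inter> S \<Longrightarrow>
      c \<le> q (ball y r) h u w"
    and h: "0 < h" and r: "0 < r" and K: "closed K" "\<And>i. i \<le> n \<Longrightarrow> ball (z i) r \<subseteq> K"
    and z: "\<And>i. i \<le> n \<Longrightarrow> dist (z i) (z (Suc i)) \<le> r / 4"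
    and x: "x \<in> ball (z 0) (r / 4) \<inter> S" and A: "A \<in> sets borel" "A \<subseteq> ball (z (Suc n)) (r / 4)"
  shows "(ennreal c * emeasure lborel (ball (0::'a) (r / 4))) ^ n * (ennreal c * emeasure lborel A)
    \<le> emeasure (P x) (confined K A (real (Suc n) * h))"
proof (rule confined_skeleton_limit)
  fix m :: nat
  show "(ennreal c * emeasure lborel (ball (0::'a) (r / 4))) ^ n * (ennreal c * emeasure lborel A)
    \<le> (restricted_transition K (h / real (2 ^ m)) ^^ (2 ^ m * Suc n)) (indicator A) x"
  proof (rule skeleton_chain[where G="\<lambda>i. ball (z i) (r / 4)"])
    fix i y B assume i: "i \<le> n" and y: "y \<in> ball (z i) (r / 4) \<inter> S"
      and B: "B \<in> sets borel" "B \<subseteq> ball (z (Suc i)) (r / 4)"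
    have sub: "ball (z (Suc i)) (r / 4) \<subseteq> ball (z i) (r / 2)"
    proof
      fix w assume "w \<in> ball (z (Suc i)) (r / 4)"
      then show "w \<in> ball (z i) (r / 2)"
        using z[OF i] dist_triangle[of "z i" w "z (Suc i)"] by simp
    qed
    have y': "y \<in> ball (z i) (r / 2) \<inter> S" "y \<in> ball (z i) r \<inter> S"
      using y r by auto
    show "ennreal c * emeasure lborel B
      \<le> (restricted_transition K (h / real (2 ^ m)) ^^ 2 ^ m) (indicator B) y"
      by (rule killed_density_skeleton_bound[OF null killed[of "z i"] h _ K(2)[OF i] _ _ y'(2),
            where G="ball (z i) (r / 2)"])
        (use K(1) B sub lower[OF y'(1)] r in auto)
  qed (use h r K x A in \<open>auto simp: emeasure_ball\<close>)
qed (use x K A h in auto)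

end

section \<open>Geometry of cubes\<close>

lemma cube_eq_box: "cube x r = box (x - (r / 2) *\<^sub>R One) (x + (r / 2) *\<^sub>R One)"
proof -
  have "\<bar>(y - x) \<bullet> b\<bar> < r / 2 \<longleftrightarrow>
      (x - (r / 2) *\<^sub>R One) \<bullet> b < y \<bullet> b \<and> y \<bullet> b < (x + (r / 2) *\<^sub>R One) \<bullet> b"
    if "b \<in> Basis" for y b
    using that by (simp add: inner_diff_left inner_add_left del: divide_less_eq_numeral1 less_divide_eq_numeral1) arith
  then show ?thesis
    by (auto simp: cube_def box_def)
qed

lemma open_cube: "open (cube x r)"
  unfolding cube_eq_box by (rule open_box)

lemma sets_cube [simp, measurable]: "cube x r \<in> sets borel"
  using open_cube by (rule borel_open)

lemma measure_cube:
  fixes x :: "'a::euclidean_space"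
  assumes "0 \<le> r" shows "measure lborel (cube x r) = r ^ DIM('a)"
  using assms unfolding cube_eq_box
  by (simp add: measure_def inner_diff_left inner_add_left prod_nonneg)

lemma emeasure_cube_finite: "emeasure lborel (cube x r) < \<infinity>"
  unfolding cube_eq_box by (rule emeasure_lborel_box_finite)

lemma cube_mono: "r \<le> s \<Longrightarrow> cube x r \<subseteq> cube x s"
  unfolding cube_def by force

lemma dist_cube_le:
  fixes x :: "'a::euclidean_space"
  assumes "y \<in> cube x r" "z \<in> cube x r"
  shows "dist y z \<le> real DIM('a) * r"
proof -
  have "dist y z \<le> (\<Sum>b\<in>Basis. \<bar>(y - z) \<bullet> b\<bar>)"
    unfolding dist_norm by (rule norm_le_l1)
  also have "\<dots> \<le> (\<Sum>b\<in>(Basis :: 'a set). r)"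
  proof (rule sum_mono)
    fix b :: 'a assume "b \<in> Basis"
    then have "\<bar>(y - x) \<bullet> b\<bar> < r / 2" "\<bar>(z - x) \<bullet> b\<bar> < r / 2"
      using assms by (auto simp: cube_def)
    then show "\<bar>(y - z) \<bullet> b\<bar> \<le> r"
      unfolding inner_diff_left by linarith
  qed
  finally show ?thesis
    by simp
qed

lemma convex_cube: "convex (cube x r)"
  unfolding cube_eq_box by (rule convex_box)

text \<open>By Bernoulli's inequality the shell between the two cubes has measure at most d \<eta>
  R^d, with d the dimension. This is at most half of the measure of B.\<close>

lemma measure_inter_smaller_cube:
  fixes x0 :: "'a::euclidean_space"
  assumes B: "B \<in> sets borel" "B \<subseteq> cube x0 R" and R: "0 < R"
    and \<eta>: "0 \<le> \<eta>" "\<eta> \<le> 1" and m: "2 * real DIM('a) * \<eta> * R ^ DIM('a) \<le> measure lborel B"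
  shows "real DIM('a) * \<eta> * R ^ DIM('a) \<le> measure lborel (B \<inter> cube x0 ((1 - \<eta>) * R))"
proof -
  let ?Q = "cube x0 R" and ?Q' = "cube x0 ((1 - \<eta>) * R)"
  note [measurable] = B(1)
  have sub: "?Q' \<subseteq> ?Q"
    using R \<eta> by (intro cube_mono) (simp add: mult_le_cancel_right1)
  have fin: "emeasure lborel B \<noteq> \<infinity>" "emeasure lborel ?Q \<noteq> \<infinity>"
    using emeasure_mono[OF B(2), of lborel] emeasure_cube_finite[of x0 R] by (auto simp: top_unique)
  have "1 - real DIM('a) * \<eta> \<le> (1 - \<eta>) ^ DIM('a)"
    using Bernoulli_inequality[of "- \<eta>" "DIM('a)"] \<eta> by simp
  then have "(1 - real DIM('a) * \<eta>) * R ^ DIM('a) \<le> ((1 - \<eta>) * R) ^ DIM('a)"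
    using R by (simp add: power_mult_distrib)
  then have "measure lborel (?Q - ?Q') \<le> real DIM('a) * \<eta> * R ^ DIM('a)"
    using R \<eta> sub fin
    by (subst measure_Diff) (auto simp: measure_cube algebra_simps)
  moreover have "measure lborel (B - ?Q') \<le> measure lborel (?Q - ?Q')"
    using B(2) fin by (intro measure_mono_fmeasurable)
      (auto simp: fmeasurable_def top.not_eq_extremum intro: le_less_trans[OF emeasure_mono])
  moreover have "measure lborel B = measure lborel (B \<inter> ?Q') + measure lborel (B - ?Q')"
  proof -
    have "measure lborel ((B \<inter> ?Q') \<union> (B - ?Q')) = measure lborel (B \<inter> ?Q') + measure lborel (B - ?Q')"
    proof (rule measure_Union)
      have "emeasure lborel (B \<inter> ?Q') \<le> emeasure lborel B" "emeasure lborel (B - ?Q') \<le> emeasure lborel B"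
        by (intro emeasure_mono; use B(1) in auto)+
      then show "emeasure lborel (B \<inter> ?Q') \<noteq> \<infinity>" "emeasure lborel (B - ?Q') \<noteq> \<infinity>"
        using fin(1) by (auto simp: top_unique)
    qed (use B(1) in auto)
    then show ?thesis
      by (simp add: Int_Diff_Un)
  qed
  ultimately show ?thesis
    using m by simp
qed

section \<open>A uniform lower bound for the occupation time\<close>

context conservative_hunt_process
begin

text \<open>Both sides are countably additive in the target set: confinement events for disjoint
  targets are disjoint, since they prescribe the position at time s. It suffices to cut B into
  countably many pieces, each inside a ball of radius \<rho> centred in G.\<close>

lemma confined_countable_cover:
  assumes x: "x \<in> S" and K: "closed K" and s: "0 \<le> s" and G: "open G" and \<rho>: "0 < \<rho>"
    and c: "\<And>y A. y \<in> G \<Longrightarrow> A \<in> sets borel \<Longrightarrow> A \<subseteq> ball y \<rho> \<Longrightarrow>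
      c * emeasure lborel A \<le> emeasure (P x) (confined K A s)"
    and B: "B \<in> sets borel" "B \<subseteq> G"
  shows "c * emeasure lborel B \<le> emeasure (P x) (confined K B s)"
proof (cases "G = {}")
  case True
  then show ?thesis
    using B by simp
next
  case False
  obtain D :: "'a set" where D: "countable D" "\<And>U. open U \<Longrightarrow> U \<noteq> {} \<Longrightarrow> \<exists>d\<in>D. d \<in> U"
    by (rule countable_dense_setE) blast
  have ne: "D \<inter> G \<noteq> {}"
    using D(2)[OF G False] by blast
  define e where "e = from_nat_into (D \<inter> G)"
  define U where "U k = ball (e k) \<rho>" for k
  define A where "A k = B \<inter> disjointed U k" for k
  have e: "range e = D \<inter> G"
    unfolding e_def using ne D(1) by (intro range_from_nat_into) auto
  have A: "A k \<in> sets borel" "A k \<subseteq> ball (e k) \<rho>" for k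
  proof -
    have "disjointed U k \<in> sets borel"
      by (rule sets.range_disjointed_sets[THEN range_subsetD]) (auto simp: U_def)
    then show "A k \<in> sets borel"
      using B by (auto simp: A_def)
    show "A k \<subseteq> ball (e k) \<rho>"
      using disjointed_subset[of U k] by (auto simp: A_def U_def)
  qed
  have dis: "disjoint_family A"
    using disjoint_family_disjointed[of U] unfolding A_def disjoint_family_on_def by blast
  have UA: "(\<Union>k. A k) = B"
  proof -
    \<comment> \<open>The centre must itself lie in G for the hypothesis to apply, hence the density
      argument in the intersection of G with the ball about w.\<close>
    have "w \<in> (\<Union>k. U k)" if "w \<in> G" for w
    proof -
      have "w \<in> G \<inter> ball w \<rho>"
        using that \<rho> by simp
      then obtain d where "d \<in> D" "d \<in> G \<inter> ball w \<rho>"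
        using D(2)[of "G \<inter> ball w \<rho>"] G by blast
      then have "d \<in> range e" "dist w d < \<rho>"
        by (auto simp: e)
      then show ?thesis
        by (auto simp: U_def dist_commute)
    qed
    moreover have "(\<Union>k. disjointed U k) = (\<Union>k. U k)"
      by (rule UN_disjointed_eq)
    ultimately show ?thesis
      using B(2) unfolding A_def by blast
  qed
  have "c * emeasure lborel B = c * (\<Sum>k. emeasure lborel (A k))"
    using A dis by (subst suminf_emeasure) (auto simp: UA)
  also have "\<dots> = (\<Sum>k. c * emeasure lborel (A k))"
    by simp
  also have "\<dots> \<le> (\<Sum>k. emeasure (P x) (confined K (A k) s))"
  proof (intro suminf_le c)
    show "e k \<in> G" for k
      using e by blast
  qed (use A in auto)
  also have "\<dots> = emeasure (P x) (\<Union>k. confined K (A k) s)"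
  proof (rule suminf_emeasure)
    show "range (\<lambda>k. confined K (A k) s) \<subseteq> sets (P x)"
      using sets_confined[OF K A(1) s] sets_P[OF x] by auto
    show "disjoint_family (\<lambda>k. confined K (A k) s)"
      using dis unfolding disjoint_family_on_def confined_def by blast
  qed
  also have "(\<Union>k. confined K (A k) s) = confined K B s"
    unfolding UA[symmetric] by (auto simp: confined_def)
  finally show ?thesis .
qed

text \<open>All constants are fixed before x0, x and B. This is possible because the constant in
  \<open>lower\<close> does not depend on the centre of the ball.\<close>

lemma occupation_time_uniform:
  fixes R \<beta> :: real and q :: "'a set \<Rightarrow> real \<Rightarrow> 'a \<Rightarrow> 'a \<Rightarrow> real"
  assumes null: "- S \<in> null_sets lebesgue"
    and killed: "\<And>y r. 0 < r \<Longrightarrow> killed_transition_density S M X P (ball y r) (q (ball y r))"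
    and lower: "\<And>r. 0 < r \<Longrightarrow> \<exists>C>0. \<forall>y. \<forall>t\<in>{1/4..1}. \<forall>u\<in>ball y (r / 2) \<inter> S.
      \<forall>w\<in>ball y (r / 2) \<inter> S. C \<le> q (ball y r) t u w"
    and R: "0 < R" and \<beta>: "0 < \<beta>" "\<beta> < 1"
  shows "\<exists>c>0. \<forall>x0. \<forall>x\<in>cube x0 (R / 2) \<inter> S. \<forall>B\<in>sets borel. B \<subseteq> cube x0 R \<longrightarrow>
    \<beta> \<le> measure lborel B / R ^ DIM('a) \<longrightarrow>
    ennreal c \<le> expected_occupation_time X P x (cube x0 R) B"
proof -
  define d where "d = real DIM('a)"
  have d: "1 \<le> d"
    by (simp add: d_def Suc_leI)
  \<comment> \<open>The relation 2 d \<eta> = \<beta> makes the shell removed from the cube carry at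
    most half of the minimal measure of B.\<close>
  define \<eta> where "\<eta> = \<beta> / (2 * d)"
  have "\<beta> < d"
    using \<beta> d by simp
  then have \<eta>: "0 < \<eta>" "\<eta> < 1 / 2" "2 * d * \<eta> = \<beta>"
    using \<beta> d by (auto simp: \<eta>_def field_simps)
  \<comment> \<open>This is exactly the gap between the faces of the inner cube, of side (1 -
    \<eta>) R, and those of K, of side (1 - \<eta>/2) R.\<close>
  define r where "r = \<eta> * R / 4"
  have r: "0 < r"
    using \<eta> R by (simp add: r_def)
  obtain C where C: "0 < C" "\<And>y t u w. t \<in> {1/4..1} \<Longrightarrow> u \<in> ball y (r / 2) \<inter> S \<Longrightarrow>
      w \<in> ball y (r / 2) \<inter> S \<Longrightarrow> C \<le> q (ball y r) t u w"
    using lower[OF r] by metis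
  \<comment> \<open>A segment in the inner cube has length at most d R, so n + 1 equal steps each
    have length at most r/4.\<close>
  obtain n :: nat where n: "4 * d * R / r < real n"
    using reals_Archimedean2 by blast
  define N where "N = real (Suc n)"
  have N: "0 < N" "d * R / N \<le> r / 4"
  proof -
    show "0 < N"
      by (simp add: N_def)
    have "4 * d * R / r < N"
      using n by (simp add: N_def)
    then show "d * R / N \<le> r / 4"
      using r \<open>0 < N\<close> by (simp add: field_simps)
  qed
  define v where "v = measure lborel (ball (0::'a) (r / 4))"
  have v: "0 < v" "emeasure lborel (ball (0::'a) (r / 4)) = ennreal v"
    using r by (auto simp: v_def measure_def emeasure_ball)
  define c1 where "c1 = (C * v) ^ n * C"
  have c1: "0 < c1"
    using C(1) v(1) by (simp add: c1_def)
  \<comment> \<open>The factors are the chaining constant, the measure guaranteed for B inside the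
    inner cube, and the length of the time interval from N/4 to N.\<close>
  define c where "c = c1 * (\<beta> / 2 * R ^ DIM('a)) * (N - N / 4)"
  have "0 < c"
    using c1 \<beta> R N(1) by (simp add: c_def)
  moreover have "ennreal c \<le> expected_occupation_time X P x (cube x0 R) B"
    if x: "x \<in> cube x0 (R / 2) \<inter> S" and B: "B \<in> sets borel" "B \<subseteq> cube x0 R"
      and Bm: "\<beta> \<le> measure lborel B / R ^ DIM('a)" for x0 x B
  proof -
    let ?Q' = "cube x0 ((1 - \<eta>) * R)"
    define K where "K = {y. \<forall>b\<in>Basis. \<bar>(y - x0) \<bullet> b\<bar> \<le> (1 - \<eta> / 2) * R / 2}"
    have "K = (\<Inter>b\<in>Basis. {y. \<bar>(y - x0) \<bullet> b\<bar> \<le> (1 - \<eta> / 2) * R / 2})"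
      by (auto simp: K_def)
    then have K: "closed K"
      by (auto intro!: closed_Collect_le continuous_intros)
    have KQ: "K \<subseteq> cube x0 R"
    proof -
      have "(1 - \<eta> / 2) * R / 2 < R / 2"
        using \<eta> R by (simp add: field_simps)
      then show ?thesis
        by (force simp: K_def cube_def)
    qed
    have ballK: "ball y r \<subseteq> K" if y: "y \<in> ?Q'" for y
    proof
      fix w assume w: "w \<in> ball y r"
      have "\<bar>(w - x0) \<bullet> b\<bar> \<le> (1 - \<eta> / 2) * R / 2" if b: "b \<in> Basis" for b
      proof -
        have "\<bar>(w - y) \<bullet> b\<bar> < r"
          using Basis_le_norm[OF b, of "w - y"] w by (simp add: dist_norm norm_minus_commute)
        moreover have "\<bar>(y - x0) \<bullet> b\<bar> < (1 - \<eta>) * R / 2"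
          using y b by (simp add: cube_def)
        moreover have "(1 - \<eta> / 2) * R / 2 = (1 - \<eta>) * R / 2 + r"
          by (simp add: r_def field_simps)
        ultimately show ?thesis
          unfolding inner_diff_left by linarith
      qed
      then show "w \<in> K"
        by (simp add: K_def)
    qed
    \<comment> \<open>Since \<eta> < 1/2, the cube of starting points is contained in the inner
      cube.\<close>
    have "R / 2 \<le> (1 - \<eta>) * R"
      using \<eta> R by (simp add: field_simps)
    then have xQ': "x \<in> ?Q'"
      using x cube_mono by blast
    have small: "ennreal c1 * emeasure lborel A \<le> emeasure (P x) (confined K A s)"
      if s: "N / 4 \<le> s" "s \<le> N" and y: "y \<in> ?Q'" and A: "A \<in> sets borel" "A \<subseteq> ball y (r / 4)"
      for s y A
    proof -
      define z where "z i = x + (real i / N) *\<^sub>R (y - x)" for i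
      \<comment> \<open>Each of the N steps takes time s / N, which lies between 1/4 and 1, the
        range covered by the constant C.\<close>
      define h where "h = s / N"
      have h: "h \<in> {1/4..1}" "real (Suc n) * h = s"
        using s N(1) unfolding N_def[symmetric] by (auto simp: h_def field_simps)
      have zQ: "z i \<in> ?Q'" if "i \<le> n" for i
      proof -
        have "z i = (1 - real i / N) *\<^sub>R x + (real i / N) *\<^sub>R y"
          by (simp add: z_def algebra_simps)
        moreover have "real i / N \<le> 1" "0 \<le> real i / N"
          using that N(1) by (auto simp: N_def)
        ultimately show ?thesis
          using convexD_alt[OF convex_cube xQ' y] by metis
      qed
      have z_dist: "dist (z i) (z (Suc i)) \<le> r / 4" for i
      proof -
        have "z i - z (Suc i) = (- (1 / N)) *\<^sub>R (y - x)"
          by (simp add: z_def add_divide_distrib algebra_simps)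
        then have "dist (z i) (z (Suc i)) = dist y x / N"
          using N(1) by (simp add: dist_norm)
        also have "\<dots> \<le> d * R / N"
        proof (rule divide_right_mono)
          have "?Q' \<subseteq> cube x0 R"
            using \<eta> R by (intro cube_mono) simp
          then show "dist y x \<le> d * R"
            unfolding d_def using y xQ' by (intro dist_cube_le[of _ x0]) auto
        qed (use N(1) in simp)
        also have "\<dots> \<le> r / 4"
          by (rule N(2))
        finally show ?thesis .
      qed
      have z0: "z 0 = x" "z (Suc n) = y"
        using N(1) unfolding z_def N_def[symmetric] by auto
      have "(ennreal C * emeasure lborel (ball (0::'a) (r / 4))) ^ n * (ennreal C * emeasure lborel A)
          \<le> emeasure (P x) (confined K A (real (Suc n) * h))"
      proof (rule confined_chain[where z=z, OF null])
        show "killed_transition_density S M X P (ball y r) (q (ball y r))" for y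
          by (rule killed[OF r])
        show "C \<le> q (ball y r) h u w" if "u \<in> ball y (r / 2) \<inter> S" "w \<in> ball y (r / 2) \<inter> S" for y u w
          by (rule C(2)[OF h(1) that])
      qed (use h(1) r K ballK zQ z_dist x A z0 in auto)
      moreover have "ennreal c1 = (ennreal C * ennreal v) ^ n * ennreal C"
        using C(1) v(1) by (simp add: c1_def ennreal_mult ennreal_power[symmetric])
      ultimately show ?thesis
        by (simp only: v(2) h(2) mult.assoc)
    qed
    let ?B = "B \<inter> ?Q'"
    have "d * \<eta> * R ^ DIM('a) \<le> measure lborel ?B"
      unfolding d_def using R \<eta> Bm B
      by (intro measure_inter_smaller_cube) (auto simp: d_def[symmetric] field_simps)
    then have Bm': "\<beta> / 2 * R ^ DIM('a) \<le> measure lborel ?B"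
      by (simp add: \<eta>(3)[symmetric])
    have "ennreal c = ennreal (c1 * (\<beta> / 2 * R ^ DIM('a))) * ennreal (N - N / 4)"
      unfolding c_def using c1 \<beta> R N(1) by (intro ennreal_mult) auto
    also have "ennreal (c1 * (\<beta> / 2 * R ^ DIM('a))) = ennreal c1 * ennreal (\<beta> / 2 * R ^ DIM('a))"
      using c1 \<beta> R by (intro ennreal_mult) auto
    also have "ennreal c1 * ennreal (\<beta> / 2 * R ^ DIM('a)) * ennreal (N - N / 4) \<le>
        ennreal c1 * emeasure lborel ?B * ennreal (N - N / 4)"
    proof (intro mult_right_mono mult_left_mono)
      have "emeasure lborel ?B \<le> emeasure lborel (cube x0 R)"
        using B open_cube by (intro emeasure_mono) auto
      also have "\<dots> < \<infinity>"
        by (rule emeasure_cube_finite)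
      finally have "emeasure lborel ?B = ennreal (measure lborel ?B)"
        by (intro emeasure_eq_ennreal_measure) auto
      then show "ennreal (\<beta> / 2 * R ^ DIM('a)) \<le> emeasure lborel ?B"
        using Bm' by (simp add: ennreal_leI)
    qed auto
    also have "\<dots> \<le> expected_occupation_time X P x (cube x0 R) ?B"
    proof (rule occupation_time_ge)
      fix s assume s: "N / 4 \<le> s" "s \<le> N"
      show "ennreal c1 * emeasure lborel ?B \<le> emeasure (P x) (confined K ?B s)"
      proof (rule confined_countable_cover[where G="?Q'" and \<rho>="r / 4"])
        show "0 \<le> s"
          using s(1) N(1) by simp
        show "ennreal c1 * emeasure lborel A \<le> emeasure (P x) (confined K A s)"
          if "y \<in> ?Q'" "A \<in> sets borel" "A \<subseteq> ball y (r / 4)" for y A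
          using s that by (rule small)
      qed (use x K r B(1) open_cube in simp_all)
    qed (use x K open_cube KQ B N(1) in auto)
    also have "\<dots> \<le> expected_occupation_time X P x (cube x0 R) B"
      unfolding expected_occupation_time_def
      by (intro nn_integral_mono mult_right_mono) (auto split: split_indicator)
    finally show ?thesis .
  qed
  ultimately show ?thesis
    by blast
qed

end

section \<open>The monotone function and the conclusion\<close>

text \<open>The infimum over all indices with m i at least \<beta> grows with \<beta>, because fewer
  indices compete, and the assumption makes it positive.\<close>

lemma monotone_profile:
  fixes occ :: "'b \<Rightarrow> ennreal" and m :: "'b \<Rightarrow> real"
  assumes "\<And>\<beta>. 0 < \<beta> \<Longrightarrow> \<beta> < 1 \<Longrightarrow> \<exists>c>0. \<forall>i\<in>I. \<beta> \<le> m i \<longrightarrow> ennreal c \<le> occ i"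
  shows "\<exists>\<phi> :: real \<Rightarrow> real. \<phi> ` {0<..<1} \<subseteq> {0<..<1} \<and> mono_on {0<..<1} \<phi> \<and>
    (\<forall>i\<in>I. 0 < m i \<longrightarrow> m i < 1 \<longrightarrow> ennreal (\<phi> (m i)) \<le> occ i)"
proof (intro exI conjI)
  \<comment> \<open>The cap 1/2 keeps the value below 1, and finite even if no index qualifies and
    the infimum is infinite.\<close>
  define g where "g \<beta> = min (ennreal (1 / 2)) (INF i\<in>{i\<in>I. \<beta> \<le> m i}. occ i)" for \<beta>
  let ?\<phi> = "\<lambda>\<beta>. enn2real (g \<beta>)"
  have fin: "g \<beta> < \<top>" for \<beta>
    unfolding g_def by (rule le_less_trans[OF min.cobounded1 ennreal_less_top])
  then have g: "ennreal (?\<phi> \<beta>) = g \<beta>" for \<beta>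
    by (rule ennreal_enn2real)
  have "?\<phi> \<beta> \<in> {0<..<1}" if "\<beta> \<in> {0<..<1}" for \<beta>
  proof -
    from assms[of \<beta>] that obtain c where "0 < c" "\<forall>i\<in>I. \<beta> \<le> m i \<longrightarrow> ennreal c \<le> occ i"
      by (metis greaterThanLessThan_iff)
    then have "ennreal (min (1 / 2) c) \<le> g \<beta>"
      unfolding g_def
      by (intro min.boundedI INF_greatest) (auto intro: order_trans[OF ennreal_leI[OF min.cobounded2]]
        ennreal_leI simp del: ennreal_half)
    moreover have "g \<beta> \<le> ennreal (1 / 2)"
      by (simp add: g_def)
    ultimately have "ennreal (min (1 / 2) c) \<le> ennreal (?\<phi> \<beta>)" "ennreal (?\<phi> \<beta>) \<le> ennreal (1 / 2)"
      by (simp_all only: g)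
    then have "min (1 / 2) c \<le> ?\<phi> \<beta>" "?\<phi> \<beta> \<le> 1 / 2"
      using \<open>0 < c\<close> by (auto simp: ennreal_le_iff2 simp del: ennreal_half ennreal_enn2real_if
          intro: order_trans[OF _ enn2real_nonneg])
    then show ?thesis
      using \<open>0 < c\<close> by auto
  qed
  then show "?\<phi> ` {0<..<1} \<subseteq> {0<..<1}"
    by auto
  have "g \<beta> \<le> g \<beta>'" if "\<beta> \<le> \<beta>'" for \<beta> \<beta>'
    unfolding g_def using that by (intro min.mono INF_superset_mono) auto
  then show "mono_on {0<..<1} ?\<phi>"
    using fin by (auto intro!: mono_onI enn2real_mono)
  show "\<forall>i\<in>I. 0 < m i \<longrightarrow> m i < 1 \<longrightarrow> ennreal (?\<phi> (m i)) \<le> occ i"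
    unfolding g by (auto simp: g_def intro!: min.coboundedI2 INF_lower)
qed

theorem theorem2:
  fixes J :: "'a::euclidean_space \<Rightarrow> 'a \<Rightarrow> real"
    and \<alpha> \<kappa>1 \<kappa>2 :: real
    and N :: "'a set"
    and M :: "'w measure"
    and F :: "ennreal \<Rightarrow> 'w measure"
    and X :: "real \<Rightarrow> 'w \<Rightarrow> 'a"
    and P :: "'a \<Rightarrow> 'w measure"
    and p :: "real \<Rightarrow> 'a \<Rightarrow> 'a \<Rightarrow> real"
    and pD :: "'a set \<Rightarrow> real \<Rightarrow> 'a \<Rightarrow> 'a \<Rightarrow> real"
  assumes kernel: "jump_kernel J \<alpha> \<kappa>1 \<kappa>2"
    and zero_capacity: "capacity J N = 0"
    and hunt: "conservative_hunt_process (- N) M F X P"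
    and form: "associated_with_form J X P"
    and density: "symmetric_transition_density (- N) M X P p"
    and killed_density: "\<And>y0 r. 0 < r \<Longrightarrow>
      killed_transition_density (- N) M X P (ball y0 r) (pD (ball y0 r))"
    and estimate_i: "\<exists>c1>0. \<exists>c2>0. \<forall>t>0. \<forall>x\<in>- N. \<forall>y\<in>- N.
      p t x y \<le> c1 * t powr (- real DIM('a) / \<alpha>) * exp (c2 * t)"
    and estimate_ii: "\<exists>c3>0. \<exists>c4>0. \<forall>t\<in>{0<..2}. \<forall>x\<in>- N. \<forall>y\<in>- N.
      1 / 16 \<le> norm (x - y) \<longrightarrow> p t x y \<le> c3 * t * exp (- c4 * norm (x - y))"
    and estimate_iii: "\<And>T \<delta> R \<epsilon>. 1 / 2 < T \<Longrightarrow> 0 < \<delta> \<Longrightarrow> \<delta> < 1 / 2 \<Longrightarrow> 0 < R \<Longrightarrow>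
      0 < \<epsilon> \<Longrightarrow> \<epsilon> < 1 \<Longrightarrow>
      \<exists>C>0. \<forall>y0. \<forall>t\<in>{\<delta>..T}. \<forall>x\<in>ball y0 (\<epsilon> * R) - N. \<forall>y\<in>ball y0 (\<epsilon> * R) - N.
        C \<le> pD (ball y0 R) t x y"
  shows "\<forall>R>0. \<exists>\<phi> :: real \<Rightarrow> real.
    \<phi> ` {0<..<1} \<subseteq> {0<..<1} \<and> mono_on {0<..<1} \<phi> \<and>
    (\<forall>x0. \<forall>x \<in> cube x0 (R / 2) - N. \<forall>B \<in> sets borel.
       B \<subseteq> cube x0 R \<longrightarrow> 0 < measure lborel B \<longrightarrow> measure lborel B < R ^ DIM('a) \<longrightarrow>
       ennreal (\<phi> (measure lborel B / R ^ DIM('a)))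
         \<le> expected_occupation_time X P x (cube x0 R) B)"
proof (intro allI impI)
  fix R :: real assume R: "0 < R"
  interpret conservative_hunt_process "- N" M F X P
    by (rule hunt)
  have null: "- (- N) \<in> null_sets lebesgue"
    using capacity_zero_null_sets[OF zero_capacity] by simp
  \<comment> \<open>Estimate (iii) is used with T = 1, \<delta> = 1/4 and \<epsilon> = 1/2.\<close>
  have lower: "\<exists>C>0. \<forall>y. \<forall>t\<in>{1/4..1}. \<forall>u\<in>ball y (r / 2) \<inter> - N.
      \<forall>w\<in>ball y (r / 2) \<inter> - N. C \<le> pD (ball y r) t u w" if "0 < r" for r
    using estimate_iii[of 1 "1 / 4" r "1 / 2"] that by (simp add: Diff_eq)
  \<comment> \<open>Taking the triples as indices makes the infimum, and hence the resulting
    function, independent of x0 and x.\<close>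
  let ?I = "{(x0, x, B). x \<in> cube x0 (R / 2) - N \<and> B \<in> sets borel \<and> B \<subseteq> cube x0 R}"
  let ?m = "\<lambda>(x0, x, B). measure lborel B / R ^ DIM('a)"
  let ?occ = "\<lambda>(x0, x, B). expected_occupation_time X P x (cube x0 R) B"
  have uniform: "\<exists>c>0. \<forall>i\<in>?I. \<beta> \<le> ?m i \<longrightarrow> ennreal c \<le> ?occ i" if \<beta>: "0 < \<beta>" "\<beta> < 1" for \<beta>
  proof -
    obtain c where "0 < c" and c: "\<forall>x0. \<forall>x\<in>cube x0 (R / 2) \<inter> - N. \<forall>B\<in>sets borel.
        B \<subseteq> cube x0 R \<longrightarrow> \<beta> \<le> measure lborel B / R ^ DIM('a) \<longrightarrow>
        ennreal c \<le> expected_occupation_time X P x (cube x0 R) B"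
      using occupation_time_uniform[where q=pD, OF null killed_density lower R \<beta>] by blast
    then show ?thesis
      by (intro exI[of _ c] conjI ballI impI) (auto intro!: c[rule_format])
  qed
  have "\<exists>\<phi> :: real \<Rightarrow> real. \<phi> ` {0<..<1} \<subseteq> {0<..<1} \<and> mono_on {0<..<1} \<phi> \<and>
      (\<forall>i\<in>?I. 0 < ?m i \<longrightarrow> ?m i < 1 \<longrightarrow> ennreal (\<phi> (?m i)) \<le> ?occ i)"
    by (rule monotone_profile) (rule uniform)
  then obtain \<phi> :: "real \<Rightarrow> real" where
    \<phi>: "\<phi> ` {0<..<1} \<subseteq> {0<..<1} \<and> mono_on {0<..<1} \<phi> \<and>
      (\<forall>i\<in>?I. 0 < ?m i \<longrightarrow> ?m i < 1 \<longrightarrow> ennreal (\<phi> (?m i)) \<le> ?occ i)"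
    by (elim exE) (rule that)
  note bound = \<phi>[THEN conjunct2, THEN conjunct2, rule_format]
  have "ennreal (\<phi> (measure lborel B / R ^ DIM('a))) \<le> expected_occupation_time X P x (cube x0 R) B"
    if "x \<in> cube x0 (R / 2) - N" "B \<in> sets borel" "B \<subseteq> cube x0 R"
      "0 < measure lborel B" "measure lborel B < R ^ DIM('a)" for x0 x B
    using bound[of "(x0, x, B)"] that R by simp
  then show "\<exists>\<phi> :: real \<Rightarrow> real.
    \<phi> ` {0<..<1} \<subseteq> {0<..<1} \<and> mono_on {0<..<1} \<phi> \<and>
    (\<forall>x0. \<forall>x \<in> cube x0 (R / 2) - N. \<forall>B \<in> sets borel.
       B \<subseteq> cube x0 R \<longrightarrow> 0 < measure lborel B \<longrightarrow> measure lborel B < R ^ DIM('a) \<longrightarrow>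
       ennreal (\<phi> (measure lborel B / R ^ DIM('a)))
         \<le> expected_occupation_time X P x (cube x0 R) B)"
    by (intro exI[of _ \<phi>] conjI \<phi>[THEN conjunct1] \<phi>[THEN conjunct2, THEN conjunct1]) auto
qed

end
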